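(* Let $\mathbb{X}$ be an extensive restriction category. There is a bijective correspondence between parametrized iteration operators on $\mathbb{X}$ (equivalently, trace operators for the coproduct of $\mathbb{X}$) and Kleene wands on $\mathbb{X}$ for the interference relation $\perp_d$. Therefore, a traced extensive restriction category is equivalently an extensive restriction category which is an itegory with respect to $\perp_d$.
   Context: Composition is diagrammatic: $fg$ means first $f$, then $g$. A restriction category is a category with an operator sending each $f:A\to B$ to $\overline{f}:A\to A$ such that $\overline{f}f=f$; $\overline{f}\,\overline{g}=\overline{g}\,\overline{f}$ and $\overline{\overline{g}f}=\overline{g}\,\overline{f}$ for $f:A\to B$, $g:A\to C$; and $f\overline{g}=\overline{fg}f$ for $f:A\to B$, $g:B\to C$. For parallel $f,g$: $f\le g$ iff $\overline{f}g=f$ (a partial order). A map $f:A\to B$ is total if $\overline{f}=1_A$. Restriction zeroes: maps $0:A\to B$ with $f0=0=0f$ and $\overline{0}=0$. An interference relation $\perp$ on a restriction category with restriction zeroes is a family of relations between maps with the same domain ($f:A\to B$, $g:A\to C$) such that: $1_A\perp 0$; $f\perp g\Rightarrow g\perp f$; $f\perp f\Rightarrow f=0$; $f'\perp g'$, $f\le f'$, $g\le g'$ imply $f\perp g$; $f\perp g\Rightarrow hfk\perp hgk'$ for all composable $h,k,k'$; $f\perp g\Rightarrow\overline{f}\perp\overline{g}$. There are all binary $\perp$-joins if any parallel $f,g:A\to B$ with $f\perp g$ have a least upper bound $f\sqcup g$ with respect to $\le$, and $h(f\sqcup g)=hf\sqcup hg$ for all $h:A'\to A$. A coCartesian restriction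 category is a restriction category with finite coproducts whose injections $\iota_j$ are total. With restriction zeroes, the quasi-projection $\iota_j^\circ:A_1+\dots+A_n\to A_j$ is the unique map with $\iota_j\iota_j^\circ=1_{A_j}$ and $\iota_i\iota_j^\circ=0$ for $i\ne j$. $\nabla:A+\dots+A\to A$ is the codiagonal; copairing is written as a column. An extensive restriction category is a coCartesian restriction category with restriction zeroes such that for every $f:A\to B_1+\dots+B_n$ there is a (necessarily unique) map $\langle f\rangle:A\to A+\dots+A$ ($n$ copies) with $\overline{f}=\langle f\rangle\nabla$ and $\langle f\rangle(f+\dots+f)=f(\iota_1+\dots+\iota_n)$. A map $d:A\to A+\dots+A$ is a decision if $\langle d\rangle=d$. In an extensive restriction category, for $f:A\to B$, $g:A\to C$, write $f\perp_d g$ iff there is a (necessarily unique) decision $\langle f\vert g\rangle:A\to A+A$ with $\langle f\vert g\rangle\iota_1^\circ=\overline{f}$ and $\langle f\vert g\rangle\iota_2^\circ=\overline{g}$. This $\perp_d$ is an interference relation for which all binary $\perp_d$-joins exist, namely $f\sqcup g=\langle f\vert g\rangle(f+g)\nabla$ for parallel $f\perp_d g$. A Kleene wand $\circledast$ for an interference relation $\perp$ with all binary $\perp$-joins assigns to each $f:X\to X$, $g:X\to A$ with $f\perp g$ a map $f\circledast g:X\to A$ such that: (1) if $f \perp g$, then $g\sqcup f(f\circledast g)=f\circledast g$; (2) $(f\circledast g)h=f\circledast gh$ for $f\perp g$, $h:A\to B$; (3) for $f:X\to Y$, $g:X\to A$, $k:Y\to X$ with $f\perp g$: $kf\circledast kg=k(fk\circledast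 g)$; (4) for $f,f':X\to X$, $g:X\to A$ with $f\perp f'$ and $f\sqcup f'\perp g$: $(f\circledast f')\perp(f\circledast g)$ and $(f\sqcup f')\circledast g=(f\circledast f')\circledast(f\circledast g)$. An itegory with respect to $\perp$ is a restriction category with restriction zeroes, an interference relation $\perp$ with all binary $\perp$-joins, and a Kleene wand for $\perp$. A parametrized iteration operator on a category with finite coproducts is a family of operators $\mathsf{Iter}^X_A$ sending $f:X\to X+A$ to $\mathsf{Iter}^X_A(f):X\to A$ such that: [Parametrized Iteration] $f\left[\begin{smallmatrix}\mathsf{Iter}^X_A(f)\\ 1_A\end{smallmatrix}\right]=\mathsf{Iter}^X_A(f)$; [Naturality] $\mathsf{Iter}^X_A(f(1_X+h))=\mathsf{Iter}^X_{A'}(f)h$ for $f:X\to X+A'$, $h:A'\to A$; [Dinaturality] $\mathsf{Iter}^X_A(kf)=k\,\mathsf{Iter}^{X'}_A(f(k+1_A))$ for $f:X'\to X+A$, $k:X\to X'$; [Diagonal] $\mathsf{Iter}^X_A(\mathsf{Iter}^X_{X+A}(f))=\mathsf{Iter}^X_A(f(\nabla_X+1_A))$ for $f:X\to X+X+A$. A trace operator for the coproduct is a family of operators sending $f:X+A\to X+B$ to $\mathsf{Tr}^X_{A,B}(f):A\to B$ (associativity isomorphisms suppressed) such that: [Tightening] $\mathsf{Tr}^X_{A',B'}((1_X+g)f(1_X+h))=g\,\mathsf{Tr}^X_{A,B}(f)\,h$ for $f:X+A\to X+B$, $g:A'\to A$, $h:B\to B'$; [Sliding] $\mathsf{Tr}^X_{A,B}(f(k+1_B))=\mathsf{Tr}^{X'}_{A,B}((k+1_A)f)$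 for $f:X+A\to X'+B$, $k:X'\to X$; [Vanishing] $\mathsf{Tr}^{X+Y}_{A,B}(f)=\mathsf{Tr}^Y_{A,B}(\mathsf{Tr}^X_{Y+A,Y+B}(f))$ for $f:X+Y+A\to X+Y+B$; [Superposing] $\mathsf{Tr}^X_{A+C,B+D}(f+g)=\mathsf{Tr}^X_{A,B}(f)+g$ for $f:X+A\to X+B$, $g:C\to D$; [Yanking] $\mathsf{Tr}^X_{X,X}(\sigma)=1_X$ for the symmetry $\sigma:X+X\to X+X$. Known fact: on a category with finite coproducts, trace operators and parametrized iteration operators are in bijection via $\mathsf{Tr}^X_{A,B}(f)=\iota_2f\left[\begin{smallmatrix}\mathsf{Iter}^X_B(\iota_1f)\\1_B\end{smallmatrix}\right]$ and $\mathsf{Iter}^X_B(f)=\mathsf{Tr}^X_{X,B}(\nabla_Xf)$. A traced extensive restriction category is an extensive restriction category equipped with a trace operator, or equivalently a parametrized iteration operator. *)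

theory Defs
  imports Main
begin

text \<open>
  Composition is diagrammatic: \<open>f \<cdot> g\<close> is first \<open>f\<close>, then \<open>g\<close>.
  Finite coproducts are chosen: there is one coproduct for every finite list of objects
  (the empty list giving the initial object), with injections numbered from \<open>0\<close>.
\<close>

record ('o, 'a) category =
  Ob :: "'o set"
  Ar :: "'a set"
  Dom :: "'a \<Rightarrow> 'o"
  Cod :: "'a \<Rightarrow> 'o"
  ident :: "'o \<Rightarrow> 'a" ("\<one>\<index>")
  comp :: "'a \<Rightarrow> 'a \<Rightarrow> 'a" (infixl "\<cdot>\<index>" 70)

record ('o, 'a) restr_category = "('o, 'a) category" +
  rst :: "'a \<Rightarrow> 'a" ("\<rho>\<index>")
  zro :: "'o \<Rightarrow> 'o \<Rightarrow> 'a" ("\<zero>\<index>")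

record ('o, 'a) coprod_restr_category = "('o, 'a) restr_category" +
  coprod :: "'o list \<Rightarrow> 'o"
  cinj :: "'o list \<Rightarrow> nat \<Rightarrow> 'a"

definition hom :: "('o, 'a, 'm) category_scheme \<Rightarrow> 'o \<Rightarrow> 'o \<Rightarrow> 'a set" where
  "hom C A B = {f \<in> Ar C. Dom C f = A \<and> Cod C f = B}"

locale category =
  fixes C :: "('o, 'a, 'm) category_scheme" (structure)
  assumes dom_ob: "f \<in> Ar C \<Longrightarrow> Dom C f \<in> Ob C"
    and cod_ob: "f \<in> Ar C \<Longrightarrow> Cod C f \<in> Ob C"
    and ident_hom: "A \<in> Ob C \<Longrightarrow> \<one> A \<in> hom C A A"
    and comp_hom: "f \<in> hom C A B \<Longrightarrow> g \<in> hom C B D \<Longrightarrow> f \<cdot> g \<in> hom C A D"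
    and ident_left: "f \<in> hom C A B \<Longrightarrow> \<one> A \<cdot> f = f"
    and ident_right: "f \<in> hom C A B \<Longrightarrow> f \<cdot> \<one> B = f"
    and comp_assoc: "f \<in> hom C A B \<Longrightarrow> g \<in> hom C B D \<Longrightarrow> h \<in> hom C D E \<Longrightarrow>
      (f \<cdot> g) \<cdot> h = f \<cdot> (g \<cdot> h)"


section \<open>Restriction categories\<close>

locale restriction_category = category C
  for C :: "('o, 'a, 'm) restr_category_scheme" (structure) +
  assumes rst_hom: "f \<in> hom C A B \<Longrightarrow> \<rho> f \<in> hom C A A"
    and rst_comp_self: "f \<in> hom C A B \<Longrightarrow> \<rho> f \<cdot> f = f"
    and rst_commute: "f \<in> hom C A B \<Longrightarrow> g \<in> hom C A D \<Longrightarrow> \<rho> f \<cdot> \<rho> g = \<rho> g \<cdot> \<rho> f"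
    and rst_rst_comp: "f \<in> hom C A B \<Longrightarrow> g \<in> hom C A D \<Longrightarrow> \<rho> (\<rho> g \<cdot> f) = \<rho> g \<cdot> \<rho> f"
    and comp_rst: "f \<in> hom C A B \<Longrightarrow> g \<in> hom C B D \<Longrightarrow> f \<cdot> \<rho> g = \<rho> (f \<cdot> g) \<cdot> f"

definition parallel :: "('o, 'a, 'm) category_scheme \<Rightarrow> 'a \<Rightarrow> 'a \<Rightarrow> bool" where
  "parallel C f g \<longleftrightarrow> f \<in> Ar C \<and> g \<in> Ar C \<and> Dom C f = Dom C g \<and> Cod C f = Cod C g"

definition restr_le :: "('o, 'a, 'm) restr_category_scheme \<Rightarrow> 'a \<Rightarrow> 'a \<Rightarrow> bool"
    (infix "\<preceq>\<index>" 50) where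
  "f \<preceq>\<^bsub>C\<^esub> g \<longleftrightarrow> parallel C f g \<and> \<rho>\<^bsub>C\<^esub> f \<cdot>\<^bsub>C\<^esub> g = f"

definition total :: "('o, 'a, 'm) restr_category_scheme \<Rightarrow> 'a \<Rightarrow> bool" where
  "total C f \<longleftrightarrow> f \<in> Ar C \<and> \<rho>\<^bsub>C\<^esub> f = \<one>\<^bsub>C\<^esub> (Dom C f)"

definition is_join :: "('o, 'a, 'm) restr_category_scheme \<Rightarrow> 'a \<Rightarrow> 'a \<Rightarrow> 'a \<Rightarrow> bool" where
  "is_join C f g j \<longleftrightarrow>
     f \<preceq>\<^bsub>C\<^esub> j \<and> g \<preceq>\<^bsub>C\<^esub> j \<and> (\<forall>u. f \<preceq>\<^bsub>C\<^esub> u \<and> g \<preceq>\<^bsub>C\<^esub> u \<longrightarrow> j \<preceq>\<^bsub>C\<^esub> u)"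

definition join :: "('o, 'a, 'm) restr_category_scheme \<Rightarrow> 'a \<Rightarrow> 'a \<Rightarrow> 'a"
    (infixl "\<squnion>\<index>" 65) where
  "f \<squnion>\<^bsub>C\<^esub> g = (THE j. is_join C f g j)"

locale restriction_category_with_zeroes = restriction_category C
  for C :: "('o, 'a, 'm) restr_category_scheme" (structure) +
  assumes zero_hom: "A \<in> Ob C \<Longrightarrow> B \<in> Ob C \<Longrightarrow> \<zero> A B \<in> hom C A B"
    and comp_zero: "f \<in> hom C A B \<Longrightarrow> D \<in> Ob C \<Longrightarrow> f \<cdot> \<zero> B D = \<zero> A D"
    and zero_comp: "f \<in> hom C A B \<Longrightarrow> D \<in> Ob C \<Longrightarrow> \<zero> D A \<cdot> f = \<zero> D B"
    and rst_zero: "A \<in> Ob C \<Longrightarrow> B \<in> Ob C \<Longrightarrow> \<rho> (\<zero> A B) = \<zero> A A"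


section \<open>Interference relations and Kleene wands\<close>

locale interference_relation = restriction_category_with_zeroes C
  for C :: "('o, 'a, 'm) restr_category_scheme" (structure) +
  fixes perp :: "'a \<Rightarrow> 'a \<Rightarrow> bool" (infix "\<bottom>" 50)
  assumes perp_same_dom: "f \<bottom> g \<Longrightarrow> f \<in> Ar C \<and> g \<in> Ar C \<and> Dom C f = Dom C g"
    and perp_one_zero: "A \<in> Ob C \<Longrightarrow> B \<in> Ob C \<Longrightarrow> \<one> A \<bottom> \<zero> A B"
    and perp_sym: "f \<bottom> g \<Longrightarrow> g \<bottom> f"
    and perp_self: "f \<bottom> f \<Longrightarrow> f = \<zero> (Dom C f) (Cod C f)"
    and perp_down: "f' \<bottom> g' \<Longrightarrow> f \<preceq> f' \<Longrightarrow> g \<preceq> g' \<Longrightarrow> f \<bottom> g"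
    and perp_comp: "f \<in> hom C A B \<Longrightarrow> g \<in> hom C A D \<Longrightarrow> f \<bottom> g \<Longrightarrow>
      h \<in> hom C A' A \<Longrightarrow> k \<in> hom C B B' \<Longrightarrow> k' \<in> hom C D D' \<Longrightarrow>
      h \<cdot> f \<cdot> k \<bottom> h \<cdot> g \<cdot> k'"
    and perp_rst: "f \<bottom> g \<Longrightarrow> \<rho> f \<bottom> \<rho> g"

locale interference_relation_with_joins = interference_relation C perp
  for C :: "('o, 'a, 'm) restr_category_scheme" (structure)
    and perp :: "'a \<Rightarrow> 'a \<Rightarrow> bool" (infix "\<bottom>" 50) +
  assumes perp_join: "f \<in> hom C A B \<Longrightarrow> g \<in> hom C A B \<Longrightarrow> f \<bottom> g \<Longrightarrow>
      \<exists>j. is_join C f g j"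
    and comp_join: "f \<in> hom C A B \<Longrightarrow> g \<in> hom C A B \<Longrightarrow> f \<bottom> g \<Longrightarrow> h \<in> hom C A' A \<Longrightarrow>
      h \<cdot> (f \<squnion> g) = (h \<cdot> f) \<squnion> (h \<cdot> g)"

definition wand_dom :: "('o, 'a, 'm) category_scheme \<Rightarrow> ('a \<Rightarrow> 'a \<Rightarrow> bool) \<Rightarrow> 'a \<Rightarrow> 'a \<Rightarrow> bool" where
  "wand_dom C perp f g \<longleftrightarrow> (\<exists>X A. f \<in> hom C X X \<and> g \<in> hom C X A \<and> perp f g)"

text \<open>
  Kleene wands, iteration operators and trace operators are partial operations. They are
  represented by HOL functions that equal \<open>undefined\<close> off their domain, so that two operators are
  equal as HOL functions exactly when they agree wherever they are defined.
\<close>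

locale kleene_wand = interference_relation_with_joins C perp
  for C :: "('o, 'a, 'm) restr_category_scheme" (structure)
    and perp :: "'a \<Rightarrow> 'a \<Rightarrow> bool" (infix "\<bottom>" 50) +
  fixes wand :: "'a \<Rightarrow> 'a \<Rightarrow> 'a" (infixl "\<circledast>" 68)
  assumes wand_undefined: "\<not> wand_dom C perp f g \<Longrightarrow> f \<circledast> g = undefined"
    and wand_hom: "f \<in> hom C X X \<Longrightarrow> g \<in> hom C X A \<Longrightarrow> f \<bottom> g \<Longrightarrow> f \<circledast> g \<in> hom C X A"
    and wand_iteration: "f \<in> hom C X X \<Longrightarrow> g \<in> hom C X A \<Longrightarrow> f \<bottom> g \<Longrightarrow>
      g \<squnion> f \<cdot> (f \<circledast> g) = f \<circledast> g"
    and wand_naturality: "f \<in> hom C X X \<Longrightarrow> g \<in> hom C X A \<Longrightarrow> f \<bottom> g \<Longrightarrow> h \<in> hom C A B \<Longrightarrow>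
      (f \<circledast> g) \<cdot> h = f \<circledast> (g \<cdot> h)"
    and wand_dinaturality: "f \<in> hom C X Y \<Longrightarrow> g \<in> hom C X A \<Longrightarrow> k \<in> hom C Y X \<Longrightarrow> f \<bottom> g \<Longrightarrow>
      (k \<cdot> f) \<circledast> (k \<cdot> g) = k \<cdot> ((f \<cdot> k) \<circledast> g)"
    and wand_diagonal_perp: "f \<in> hom C X X \<Longrightarrow> f' \<in> hom C X X \<Longrightarrow> g \<in> hom C X A \<Longrightarrow>
      f \<bottom> f' \<Longrightarrow> f \<squnion> f' \<bottom> g \<Longrightarrow> (f \<circledast> f') \<bottom> (f \<circledast> g)"
    and wand_diagonal: "f \<in> hom C X X \<Longrightarrow> f' \<in> hom C X X \<Longrightarrow> g \<in> hom C X A \<Longrightarrow>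
      f \<bottom> f' \<Longrightarrow> f \<squnion> f' \<bottom> g \<Longrightarrow> (f \<squnion> f') \<circledast> g = (f \<circledast> f') \<circledast> (f \<circledast> g)"

locale itegory = kleene_wand C perp wand
  for C :: "('o, 'a, 'm) restr_category_scheme" (structure)
    and perp :: "'a \<Rightarrow> 'a \<Rightarrow> bool" (infix "\<bottom>" 50)
    and wand :: "'a \<Rightarrow> 'a \<Rightarrow> 'a" (infixl "\<circledast>" 68)


section \<open>Finite coproducts\<close>

locale category_with_finite_coproducts = category C
  for C :: "('o, 'a, 'm) coprod_restr_category_scheme" (structure) +
  assumes coprod_ob: "set Bs \<subseteq> Ob C \<Longrightarrow> coprod C Bs \<in> Ob C"
    and cinj_hom: "set Bs \<subseteq> Ob C \<Longrightarrow> i < length Bs \<Longrightarrow>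
      cinj C Bs i \<in> hom C (Bs ! i) (coprod C Bs)"
    and coprod_universal: "set Bs \<subseteq> Ob C \<Longrightarrow> D \<in> Ob C \<Longrightarrow> length fs = length Bs \<Longrightarrow>
      (\<And>i. i < length Bs \<Longrightarrow> fs ! i \<in> hom C (Bs ! i) D) \<Longrightarrow>
      \<exists>!h. h \<in> hom C (coprod C Bs) D \<and> (\<forall>i<length Bs. cinj C Bs i \<cdot> h = fs ! i)"

definition cotuple :: "('o, 'a, 'm) coprod_restr_category_scheme \<Rightarrow> 'o \<Rightarrow> 'a list \<Rightarrow> 'a" where
  "cotuple C D fs = (let Bs = map (Dom C) fs in
     THE h. h \<in> hom C (coprod C Bs) D \<and> (\<forall>i<length Bs. cinj C Bs i \<cdot>\<^bsub>C\<^esub> h = fs ! i))"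

definition sum_map :: "('o, 'a, 'm) coprod_restr_category_scheme \<Rightarrow> 'a list \<Rightarrow> 'a" where
  "sum_map C fs = (let Ds = map (Cod C) fs in
     cotuple C (coprod C Ds) (map (\<lambda>i. (fs ! i) \<cdot>\<^bsub>C\<^esub> cinj C Ds i) [0..<length fs]))"

definition codiag :: "('o, 'a, 'm) coprod_restr_category_scheme \<Rightarrow> nat \<Rightarrow> 'o \<Rightarrow> 'a" where
  "codiag C n A = cotuple C A (replicate n (\<one>\<^bsub>C\<^esub> A))"

definition sum2 :: "('o, 'a, 'm) coprod_restr_category_scheme \<Rightarrow> 'o \<Rightarrow> 'o \<Rightarrow> 'o"
    (infixl "\<boxplus>\<index>" 65) where
  "A \<boxplus>\<^bsub>C\<^esub> B = coprod C [A, B]"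

definition inj1 :: "('o, 'a, 'm) coprod_restr_category_scheme \<Rightarrow> 'o \<Rightarrow> 'o \<Rightarrow> 'a" ("\<iota>\<^sub>1\<index>") where
  "\<iota>\<^sub>1\<^bsub>C\<^esub> A B = cinj C [A, B] 0"

definition inj2 :: "('o, 'a, 'm) coprod_restr_category_scheme \<Rightarrow> 'o \<Rightarrow> 'o \<Rightarrow> 'a" ("\<iota>\<^sub>2\<index>") where
  "\<iota>\<^sub>2\<^bsub>C\<^esub> A B = cinj C [A, B] 1"

definition copair :: "('o, 'a, 'm) coprod_restr_category_scheme \<Rightarrow> 'a \<Rightarrow> 'a \<Rightarrow> 'a" where
  "copair C f g = cotuple C (Cod C f) [f, g]"

definition sum_map2 :: "('o, 'a, 'm) coprod_restr_category_scheme \<Rightarrow> 'a \<Rightarrow> 'a \<Rightarrow> 'a"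
    (infixl "\<oplus>\<index>" 65) where
  "f \<oplus>\<^bsub>C\<^esub> g = sum_map C [f, g]"

definition codiag2 :: "('o, 'a, 'm) coprod_restr_category_scheme \<Rightarrow> 'o \<Rightarrow> 'a" ("\<nabla>\<index>") where
  "\<nabla>\<^bsub>C\<^esub> A = codiag C 2 A"

definition symm :: "('o, 'a, 'm) coprod_restr_category_scheme \<Rightarrow> 'o \<Rightarrow> 'o \<Rightarrow> 'a" ("\<sigma>\<index>") where
  "\<sigma>\<^bsub>C\<^esub> A B = copair C (\<iota>\<^sub>2\<^bsub>C\<^esub> B A) (\<iota>\<^sub>1\<^bsub>C\<^esub> B A)"

text \<open>\<open>\<alpha> A B D\<close> is the associativity isomorphism from \<open>A + (B + D)\<close> to \<open>(A + B) + D\<close>,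
  and \<open>\<beta> A B D\<close> is its inverse.\<close>

definition assoc :: "('o, 'a, 'm) coprod_restr_category_scheme \<Rightarrow> 'o \<Rightarrow> 'o \<Rightarrow> 'o \<Rightarrow> 'a" ("\<alpha>\<index>") where
  "\<alpha>\<^bsub>C\<^esub> A B D =
     copair C (\<iota>\<^sub>1\<^bsub>C\<^esub> A B \<cdot>\<^bsub>C\<^esub> \<iota>\<^sub>1\<^bsub>C\<^esub> (A \<boxplus>\<^bsub>C\<^esub> B) D)
       (copair C (\<iota>\<^sub>2\<^bsub>C\<^esub> A B \<cdot>\<^bsub>C\<^esub> \<iota>\<^sub>1\<^bsub>C\<^esub> (A \<boxplus>\<^bsub>C\<^esub> B) D) (\<iota>\<^sub>2\<^bsub>C\<^esub> (A \<boxplus>\<^bsub>C\<^esub> B) D))"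

definition assoc_inv :: "('o, 'a, 'm) coprod_restr_category_scheme \<Rightarrow> 'o \<Rightarrow> 'o \<Rightarrow> 'o \<Rightarrow> 'a" ("\<beta>\<index>") where
  "\<beta>\<^bsub>C\<^esub> A B D =
     copair C
       (copair C (\<iota>\<^sub>1\<^bsub>C\<^esub> A (B \<boxplus>\<^bsub>C\<^esub> D)) (\<iota>\<^sub>1\<^bsub>C\<^esub> B D \<cdot>\<^bsub>C\<^esub> \<iota>\<^sub>2\<^bsub>C\<^esub> A (B \<boxplus>\<^bsub>C\<^esub> D)))
       (\<iota>\<^sub>2\<^bsub>C\<^esub> B D \<cdot>\<^bsub>C\<^esub> \<iota>\<^sub>2\<^bsub>C\<^esub> A (B \<boxplus>\<^bsub>C\<^esub> D))"


section \<open>Parametrized iteration and trace operators\<close>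

text \<open>The objects are explicit arguments of the operators, because a map into \<open>X + A\<close> need not
  determine \<open>A\<close>.\<close>

definition iter_dom :: "('o, 'a, 'm) coprod_restr_category_scheme \<Rightarrow> 'o \<Rightarrow> 'o \<Rightarrow> 'a \<Rightarrow> bool" where
  "iter_dom C X A f \<longleftrightarrow> X \<in> Ob C \<and> A \<in> Ob C \<and> f \<in> hom C X (X \<boxplus>\<^bsub>C\<^esub> A)"

locale parametrized_iteration_operator = category_with_finite_coproducts C
  for C :: "('o, 'a, 'm) coprod_restr_category_scheme" (structure) +
  fixes Iter :: "'o \<Rightarrow> 'o \<Rightarrow> 'a \<Rightarrow> 'a"
  assumes iter_undefined: "\<not> iter_dom C X A f \<Longrightarrow> Iter X A f = undefined"
    and iter_hom: "X \<in> Ob C \<Longrightarrow> A \<in> Ob C \<Longrightarrow> f \<in> hom C X (X \<boxplus> A) \<Longrightarrow> Iter X A f \<in> hom C X A"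
    and iter_iteration: "X \<in> Ob C \<Longrightarrow> A \<in> Ob C \<Longrightarrow> f \<in> hom C X (X \<boxplus> A) \<Longrightarrow>
      f \<cdot> copair C (Iter X A f) (\<one> A) = Iter X A f"
    and iter_naturality: "X \<in> Ob C \<Longrightarrow> f \<in> hom C X (X \<boxplus> A') \<Longrightarrow> h \<in> hom C A' A \<Longrightarrow>
      Iter X A (f \<cdot> (\<one> X \<oplus> h)) = Iter X A' f \<cdot> h"
    and iter_dinaturality: "A \<in> Ob C \<Longrightarrow> f \<in> hom C X' (X \<boxplus> A) \<Longrightarrow> k \<in> hom C X X' \<Longrightarrow>
      Iter X A (k \<cdot> f) = k \<cdot> Iter X' A (f \<cdot> (k \<oplus> \<one> A))"
    and iter_diagonal: "X \<in> Ob C \<Longrightarrow> A \<in> Ob C \<Longrightarrow> f \<in> hom C X (X \<boxplus> (X \<boxplus> A)) \<Longrightarrow>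
      Iter X A (Iter X (X \<boxplus> A) f) = Iter X A (f \<cdot> \<alpha> X X A \<cdot> (\<nabla> X \<oplus> \<one> A))"

definition trace_dom :: "('o, 'a, 'm) coprod_restr_category_scheme \<Rightarrow> 'o \<Rightarrow> 'o \<Rightarrow> 'o \<Rightarrow> 'a \<Rightarrow> bool" where
  "trace_dom C X A B f \<longleftrightarrow>
     X \<in> Ob C \<and> A \<in> Ob C \<and> B \<in> Ob C \<and> f \<in> hom C (X \<boxplus>\<^bsub>C\<^esub> A) (X \<boxplus>\<^bsub>C\<^esub> B)"

locale trace_operator = category_with_finite_coproducts C
  for C :: "('o, 'a, 'm) coprod_restr_category_scheme" (structure) +
  fixes Tr :: "'o \<Rightarrow> 'o \<Rightarrow> 'o \<Rightarrow> 'a \<Rightarrow> 'a"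
  assumes trace_undefined: "\<not> trace_dom C X A B f \<Longrightarrow> Tr X A B f = undefined"
    and trace_hom: "X \<in> Ob C \<Longrightarrow> A \<in> Ob C \<Longrightarrow> B \<in> Ob C \<Longrightarrow> f \<in> hom C (X \<boxplus> A) (X \<boxplus> B) \<Longrightarrow>
      Tr X A B f \<in> hom C A B"
    and trace_tightening: "X \<in> Ob C \<Longrightarrow> f \<in> hom C (X \<boxplus> A) (X \<boxplus> B) \<Longrightarrow>
      g \<in> hom C A' A \<Longrightarrow> h \<in> hom C B B' \<Longrightarrow>
      Tr X A' B' ((\<one> X \<oplus> g) \<cdot> f \<cdot> (\<one> X \<oplus> h)) = g \<cdot> Tr X A B f \<cdot> h"
    and trace_sliding: "A \<in> Ob C \<Longrightarrow> B \<in> Ob C \<Longrightarrow> f \<in> hom C (X \<boxplus> A) (X' \<boxplus> B) \<Longrightarrow>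
      k \<in> hom C X' X \<Longrightarrow>
      Tr X A B (f \<cdot> (k \<oplus> \<one> B)) = Tr X' A B ((k \<oplus> \<one> A) \<cdot> f)"
    and trace_vanishing: "X \<in> Ob C \<Longrightarrow> Y \<in> Ob C \<Longrightarrow> A \<in> Ob C \<Longrightarrow> B \<in> Ob C \<Longrightarrow>
      f \<in> hom C ((X \<boxplus> Y) \<boxplus> A) ((X \<boxplus> Y) \<boxplus> B) \<Longrightarrow>
      Tr (X \<boxplus> Y) A B f = Tr Y A B (Tr X (Y \<boxplus> A) (Y \<boxplus> B) (\<alpha> X Y A \<cdot> f \<cdot> \<beta> X Y B))"
    and trace_superposing: "X \<in> Ob C \<Longrightarrow> A \<in> Ob C \<Longrightarrow> B \<in> Ob C \<Longrightarrow>
      f \<in> hom C (X \<boxplus> A) (X \<boxplus> B) \<Longrightarrow> g \<in> hom C D E \<Longrightarrow>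
      Tr X (A \<boxplus> D) (B \<boxplus> E) (\<alpha> X A D \<cdot> (f \<oplus> g) \<cdot> \<beta> X B E) = Tr X A B f \<oplus> g"
    and trace_yanking: "X \<in> Ob C \<Longrightarrow> Tr X X X (\<sigma> X X) = \<one> X"

definition trace_of_iter :: "('o, 'a, 'm) coprod_restr_category_scheme \<Rightarrow>
    ('o \<Rightarrow> 'o \<Rightarrow> 'a \<Rightarrow> 'a) \<Rightarrow> ('o \<Rightarrow> 'o \<Rightarrow> 'o \<Rightarrow> 'a \<Rightarrow> 'a)" where
  "trace_of_iter C Iter X A B f =
     (if trace_dom C X A B f
      then \<iota>\<^sub>2\<^bsub>C\<^esub> X A \<cdot>\<^bsub>C\<^esub> f \<cdot>\<^bsub>C\<^esub> copair C (Iter X B (\<iota>\<^sub>1\<^bsub>C\<^esub> X A \<cdot>\<^bsub>C\<^esub> f)) (\<one>\<^bsub>C\<^esub> B)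
      else undefined)"

definition iter_of_trace :: "('o, 'a, 'm) coprod_restr_category_scheme \<Rightarrow>
    ('o \<Rightarrow> 'o \<Rightarrow> 'o \<Rightarrow> 'a \<Rightarrow> 'a) \<Rightarrow> ('o \<Rightarrow> 'o \<Rightarrow> 'a \<Rightarrow> 'a)" where
  "iter_of_trace C Tr X B f =
     (if iter_dom C X B f then Tr X X B (\<nabla>\<^bsub>C\<^esub> X \<cdot>\<^bsub>C\<^esub> f) else undefined)"


section \<open>Extensive restriction categories\<close>

locale cocartesian_restriction_category = restriction_category C + category_with_finite_coproducts C
  for C :: "('o, 'a, 'm) coprod_restr_category_scheme" (structure) +
  assumes cinj_total: "set Bs \<subseteq> Ob C \<Longrightarrow> i < length Bs \<Longrightarrow> total C (cinj C Bs i)"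

definition quasi_proj :: "('o, 'a, 'm) coprod_restr_category_scheme \<Rightarrow> 'o list \<Rightarrow> nat \<Rightarrow> 'a" where
  "quasi_proj C As j =
     (THE q. q \<in> hom C (coprod C As) (As ! j) \<and>
        cinj C As j \<cdot>\<^bsub>C\<^esub> q = \<one>\<^bsub>C\<^esub> (As ! j) \<and>
        (\<forall>i<length As. i \<noteq> j \<longrightarrow> cinj C As i \<cdot>\<^bsub>C\<^esub> q = \<zero>\<^bsub>C\<^esub> (As ! i) (As ! j)))"

text \<open>\<open>is_bracket C Bs f d\<close> says that \<open>d\<close> satisfies the two equations for \<open>\<langle>f\<rangle>\<close>, where \<open>f\<close> is a map
  into the coproduct of \<open>Bs\<close>.\<close>

definition is_bracket :: "('o, 'a, 'm) coprod_restr_category_scheme \<Rightarrow> 'o list \<Rightarrow> 'a \<Rightarrow> 'a \<Rightarrow> bool" where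
  "is_bracket C Bs f d \<longleftrightarrow>
     (let n = length Bs; A = Dom C f in
        d \<in> hom C A (coprod C (replicate n A)) \<and>
        \<rho>\<^bsub>C\<^esub> f = d \<cdot>\<^bsub>C\<^esub> codiag C n A \<and>
        d \<cdot>\<^bsub>C\<^esub> sum_map C (replicate n f) = f \<cdot>\<^bsub>C\<^esub> sum_map C (map (cinj C Bs) [0..<n]))"

definition bracket :: "('o, 'a, 'm) coprod_restr_category_scheme \<Rightarrow> 'o list \<Rightarrow> 'a \<Rightarrow> 'a" where
  "bracket C Bs f = (THE d. is_bracket C Bs f d)"

locale extensive_restriction_category =
  cocartesian_restriction_category C + restriction_category_with_zeroes C
  for C :: "('o, 'a, 'm) coprod_restr_category_scheme" (structure) +
  assumes extensive: "set Bs \<subseteq> Ob C \<Longrightarrow> f \<in> hom C A (coprod C Bs) \<Longrightarrow> \<exists>d. is_bracket C Bs f d"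

definition is_decision :: "('o, 'a, 'm) coprod_restr_category_scheme \<Rightarrow> nat \<Rightarrow> 'o \<Rightarrow> 'a \<Rightarrow> bool" where
  "is_decision C n A d \<longleftrightarrow>
     d \<in> hom C A (coprod C (replicate n A)) \<and> bracket C (replicate n A) d = d"

definition is_separating_decision ::
    "('o, 'a, 'm) coprod_restr_category_scheme \<Rightarrow> 'a \<Rightarrow> 'a \<Rightarrow> 'a \<Rightarrow> bool" where
  "is_separating_decision C f g d \<longleftrightarrow>
     (let A = Dom C f in
        is_decision C 2 A d \<and>
        d \<cdot>\<^bsub>C\<^esub> quasi_proj C [A, A] 0 = \<rho>\<^bsub>C\<^esub> f \<and>
        d \<cdot>\<^bsub>C\<^esub> quasi_proj C [A, A] 1 = \<rho>\<^bsub>C\<^esub> g)"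

definition perp_d :: "('o, 'a, 'm) coprod_restr_category_scheme \<Rightarrow> 'a \<Rightarrow> 'a \<Rightarrow> bool" where
  "perp_d C f g \<longleftrightarrow>
     f \<in> Ar C \<and> g \<in> Ar C \<and> Dom C f = Dom C g \<and> (\<exists>d. is_separating_decision C f g d)"

definition separating_decision ::
    "('o, 'a, 'm) coprod_restr_category_scheme \<Rightarrow> 'a \<Rightarrow> 'a \<Rightarrow> 'a" ("\<langle>_|_\<rangle>\<index>") where
  "\<langle>f|g\<rangle>\<^bsub>C\<^esub> = (THE d. is_separating_decision C f g d)"

text \<open>The correspondence sends \<open>Iter\<close> to \<open>f \<circledast> g = Iter (\<langle>f|g\<rangle> (f + g))\<close>; conversely, a wand yields
  \<open>Iter f = f \<iota>\<^sub>1\<degree> \<circledast> f \<iota>\<^sub>2\<degree>\<close>, with \<open>\<iota>\<^sub>1\<degree>\<close> and \<open>\<iota>\<^sub>2\<degree>\<close> the quasi-projections of \<open>X + A\<close>.\<close>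

definition wand_of_iter :: "('o, 'a, 'm) coprod_restr_category_scheme \<Rightarrow>
    ('o \<Rightarrow> 'o \<Rightarrow> 'a \<Rightarrow> 'a) \<Rightarrow> ('a \<Rightarrow> 'a \<Rightarrow> 'a)" where
  "wand_of_iter C Iter f g =
     (if wand_dom C (perp_d C) f g
      then Iter (Dom C f) (Cod C g) (\<langle>f|g\<rangle>\<^bsub>C\<^esub> \<cdot>\<^bsub>C\<^esub> (f \<oplus>\<^bsub>C\<^esub> g))
      else undefined)"

definition iter_of_wand :: "('o, 'a, 'm) coprod_restr_category_scheme \<Rightarrow>
    ('a \<Rightarrow> 'a \<Rightarrow> 'a) \<Rightarrow> ('o \<Rightarrow> 'o \<Rightarrow> 'a \<Rightarrow> 'a)" where
  "iter_of_wand C wand X A f =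
     (if iter_dom C X A f
      then wand (f \<cdot>\<^bsub>C\<^esub> quasi_proj C [X, A] 0) (f \<cdot>\<^bsub>C\<^esub> quasi_proj C [X, A] 1)
      else undefined)"

locale traced_extensive_restriction_category =
  extensive_restriction_category C + trace_operator C Tr
  for C :: "('o, 'a, 'm) coprod_restr_category_scheme" (structure)
    and Tr :: "'o \<Rightarrow> 'o \<Rightarrow> 'o \<Rightarrow> 'a \<Rightarrow> 'a"

end

theory Submission
  imports Defs
begin

text \<open>
  In an extensive restriction category the quasi-projections of \<open>B + D\<close> are jointly monic, and a pair
  \<open>f : A \<rightarrow> B\<close>, \<open>g : A \<rightarrow> D\<close> arises as the components of a map \<open>A \<rightarrow> B + D\<close> exactly when \<open>f\<close> and \<open>g\<close>
  are separated by a decision. Hence an operator on maps \<open>X \<rightarrow> X + A\<close> is the same thing as an operator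
  on pairs \<open>X \<rightarrow> X\<close>, \<open>X \<rightarrow> A\<close> related by \<open>perp_d\<close>; since the join of such a pair is its pairing followed
  by the codiagonal, the four iteration axioms translate one by one into the four wand axioms.

  For traces and iteration, vanishing is the Bekic identity, which follows from dinaturality and the
  diagonal law; conversely, a trace satisfies \<open>Tr [p; q] = q [Tr [p; \<iota>\<^sub>1]; 1]\<close>, so it is determined
  by the iteration \<open>Tr [p; \<iota>\<^sub>1] = Tr [p; p]\<close>.
\<close>

section \<open>Categories with finite coproducts\<close>

context category
begin

lemma hom_iff: "f \<in> hom C A B \<longleftrightarrow> f \<in> Ar C \<and> Dom C f = A \<and> Cod C f = B"
  by (auto simp: hom_def)

lemma homD: "f \<in> hom C A B \<Longrightarrow> f \<in> Ar C \<and> Dom C f = A \<and> Cod C f = B \<and> A \<in> Ob C \<and> B \<in> Ob C"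
  using dom_ob cod_ob by (auto simp: hom_def)

lemma dom_cod_ob [simp]: "f \<in> Ar C \<Longrightarrow> Dom C f \<in> Ob C" "f \<in> Ar C \<Longrightarrow> Cod C f \<in> Ob C"
  by (simp_all add: dom_ob cod_ob)

lemma ident_arr [simp]:
  assumes "A \<in> Ob C"
  shows "\<one> A \<in> Ar C" "Dom C (\<one> A) = A" "Cod C (\<one> A) = A"
  using ident_hom[OF assms] by (simp_all add: hom_iff)

lemma comp_arr [simp]:
  assumes "f \<in> Ar C" "g \<in> Ar C" "Cod C f = Dom C g"
  shows "f \<cdot> g \<in> Ar C" "Dom C (f \<cdot> g) = Dom C f" "Cod C (f \<cdot> g) = Cod C g"
  using comp_hom[of f "Dom C f" "Dom C g" g "Cod C g"] assms by (simp_all add: hom_iff)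

lemma ident_comp [simp]: "f \<in> Ar C \<Longrightarrow> Dom C f = A \<Longrightarrow> \<one> A \<cdot> f = f"
  by (rule ident_left) (simp add: hom_iff)

lemma comp_ident [simp]: "f \<in> Ar C \<Longrightarrow> Cod C f = B \<Longrightarrow> f \<cdot> \<one> B = f"
  by (rule ident_right) (simp add: hom_iff)

text \<open>The objects in \<open>comp_assoc\<close> occur only in its premises, where rewriting
  cannot find them; conditions on \<open>Dom\<close> and \<open>Cod\<close> can be discharged by
  simplification. The neighbouring axioms are restated for the same reason.\<close>

lemma comp_assoc_arr [simp]:
  assumes "f \<in> Ar C" "g \<in> Ar C" "h \<in> Ar C" "Cod C f = Dom C g" "Cod C g = Dom C h"
  shows "f \<cdot> g \<cdot> h = f \<cdot> (g \<cdot> h)"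
  by (rule comp_assoc) (use assms in \<open>auto simp: hom_iff\<close>)

end

context category_with_finite_coproducts
begin

lemma sum2_ob [simp]: "A \<in> Ob C \<Longrightarrow> B \<in> Ob C \<Longrightarrow> A \<boxplus> B \<in> Ob C"
  by (simp add: sum2_def coprod_ob)

lemma inj1_arr [simp]:
  assumes "A \<in> Ob C" "B \<in> Ob C"
  shows "\<iota>\<^sub>1 A B \<in> Ar C" "Dom C (\<iota>\<^sub>1 A B) = A" "Cod C (\<iota>\<^sub>1 A B) = A \<boxplus> B"
  using cinj_hom[of "[A, B]" 0] assms by (simp_all add: hom_iff inj1_def sum2_def)

lemma inj2_arr [simp]:
  assumes "A \<in> Ob C" "B \<in> Ob C"
  shows "\<iota>\<^sub>2 A B \<in> Ar C" "Dom C (\<iota>\<^sub>2 A B) = B" "Cod C (\<iota>\<^sub>2 A B) = A \<boxplus> B"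
  using cinj_hom[of "[A, B]" 1] assms by (simp_all add: hom_iff inj2_def sum2_def)

lemma copair_ex1:
  assumes "f \<in> Ar C" "g \<in> Ar C" "Cod C f = D" "Cod C g = D"
  shows "\<exists>!h. h \<in> hom C (Dom C f \<boxplus> Dom C g) D \<and>
    \<iota>\<^sub>1 (Dom C f) (Dom C g) \<cdot> h = f \<and> \<iota>\<^sub>2 (Dom C f) (Dom C g) \<cdot> h = g"
proof -
  have "\<exists>!h. h \<in> hom C (coprod C [Dom C f, Dom C g]) D \<and>
      (\<forall>i<length [Dom C f, Dom C g]. cinj C [Dom C f, Dom C g] i \<cdot> h = [f, g] ! i)"
    by (rule coprod_universal) (use assms in \<open>auto simp: less_Suc_eq hom_iff\<close>)
  moreover have "(\<forall>i<length [Dom C f, Dom C g]. cinj C [Dom C f, Dom C g] i \<cdot> h = [f, g] ! i) \<longleftrightarrow>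
      \<iota>\<^sub>1 (Dom C f) (Dom C g) \<cdot> h = f \<and> \<iota>\<^sub>2 (Dom C f) (Dom C g) \<cdot> h = g" for h
    by (auto simp: less_Suc_eq inj1_def inj2_def)
  ultimately show ?thesis
    by (simp only: sum2_def)
qed

lemma copair_eq_The:
  "copair C f g = (THE h. h \<in> hom C (Dom C f \<boxplus> Dom C g) (Cod C f) \<and>
    \<iota>\<^sub>1 (Dom C f) (Dom C g) \<cdot> h = f \<and> \<iota>\<^sub>2 (Dom C f) (Dom C g) \<cdot> h = g)"
  unfolding copair_def cotuple_def Let_def inj1_def inj2_def sum2_def
  by (rule arg_cong[where f = The]) (auto simp: less_Suc_eq)

lemma copair_props:
  assumes "f \<in> Ar C" "g \<in> Ar C" "Cod C f = Cod C g"
  shows "copair C f g \<in> hom C (Dom C f \<boxplus> Dom C g) (Cod C f) \<and>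
    \<iota>\<^sub>1 (Dom C f) (Dom C g) \<cdot> copair C f g = f \<and> \<iota>\<^sub>2 (Dom C f) (Dom C g) \<cdot> copair C f g = g"
  unfolding copair_eq_The by (rule theI') (use copair_ex1 assms in auto)

lemma copair_arr [simp]:
  assumes "f \<in> Ar C" "g \<in> Ar C" "Cod C f = Cod C g"
  shows "copair C f g \<in> Ar C" "Dom C (copair C f g) = Dom C f \<boxplus> Dom C g"
    "Cod C (copair C f g) = Cod C g"
  using copair_props[OF assms] assms by (simp_all add: hom_iff)

lemma inj_copair [simp]:
  assumes "f \<in> Ar C" "g \<in> Ar C" "Cod C f = Cod C g" "Dom C f = A" "Dom C g = B"
  shows "\<iota>\<^sub>1 A B \<cdot> copair C f g = f" "\<iota>\<^sub>2 A B \<cdot> copair C f g = g"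
  using copair_props[of f g] assms by simp_all

lemma inj_copair_comp [simp]:
  assumes "f \<in> Ar C" "g \<in> Ar C" "Cod C f = Cod C g" "Dom C f = A" "Dom C g = B"
    "h \<in> Ar C" "Dom C h = Cod C g"
  shows "\<iota>\<^sub>1 A B \<cdot> (copair C f g \<cdot> h) = f \<cdot> h" "\<iota>\<^sub>2 A B \<cdot> (copair C f g \<cdot> h) = g \<cdot> h"
  using assms comp_assoc_arr[of "\<iota>\<^sub>1 A B" "copair C f g" h]
    comp_assoc_arr[of "\<iota>\<^sub>2 A B" "copair C f g" h] by auto

lemma copair_eqI:
  assumes "h \<in> Ar C" "k \<in> Ar C" "Dom C h = A \<boxplus> B" "Dom C k = A \<boxplus> B" "Cod C h = Cod C k"
    "A \<in> Ob C" "B \<in> Ob C" "\<iota>\<^sub>1 A B \<cdot> h = \<iota>\<^sub>1 A B \<cdot> k" "\<iota>\<^sub>2 A B \<cdot> h = \<iota>\<^sub>2 A B \<cdot> k"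
  shows "h = k"
  using copair_ex1[of "\<iota>\<^sub>1 A B \<cdot> h" "\<iota>\<^sub>2 A B \<cdot> h" "Cod C h"] assms
  by (auto simp: hom_iff)

lemma copair_eta [simp]:
  assumes "h \<in> Ar C" "Dom C h = A \<boxplus> B" "A \<in> Ob C" "B \<in> Ob C"
  shows "copair C (\<iota>\<^sub>1 A B \<cdot> h) (\<iota>\<^sub>2 A B \<cdot> h) = h"
  by (rule copair_eqI[of _ _ A B]) (use assms in auto)

lemma copair_inj [simp]: "A \<in> Ob C \<Longrightarrow> B \<in> Ob C \<Longrightarrow> copair C (\<iota>\<^sub>1 A B) (\<iota>\<^sub>2 A B) = \<one> (A \<boxplus> B)"
  by (rule copair_eqI[of _ _ A B]) auto

lemma copair_comp [simp]:
  assumes "f \<in> Ar C" "g \<in> Ar C" "Cod C f = Cod C g" "h \<in> Ar C" "Dom C h = Cod C g"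
  shows "copair C f g \<cdot> h = copair C (f \<cdot> h) (g \<cdot> h)"
  by (rule copair_eqI[of _ _ "Dom C f" "Dom C g"]) (use assms in auto)

text \<open>Sums, codiagonals and structural isomorphisms are all rewritten to copairs, through
  which \<open>copair_comp\<close> pushes later maps. Equations between composites of structure maps
  thus reduce to comparing normal forms.\<close>

lemma sum_map2_eq [simp]:
  assumes "f \<in> Ar C" "g \<in> Ar C"
  shows "f \<oplus> g = copair C (f \<cdot> \<iota>\<^sub>1 (Cod C f) (Cod C g)) (g \<cdot> \<iota>\<^sub>2 (Cod C f) (Cod C g))"
proof -
  have "[0..<2] = [0, 1]"
    by (simp add: numeral_2_eq_2)
  moreover have "Cod C (f \<cdot> \<iota>\<^sub>1 (Cod C f) (Cod C g)) = Cod C f \<boxplus> Cod C g"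
    using assms by simp
  ultimately show ?thesis
    using assms by (simp add: sum_map2_def sum_map_def copair_def Let_def inj1_def inj2_def sum2_def)
qed

lemma codiag2_eq [simp]:
  assumes "A \<in> Ob C" shows "\<nabla> A = copair C (\<one> A) (\<one> A)"
  using assms by (simp add: codiag2_def codiag_def copair_def numeral_2_eq_2)

lemmas structure_maps [simp] = symm_def assoc_def assoc_inv_def

end

section \<open>Traces from iteration operators\<close>

context parametrized_iteration_operator
begin

lemma Iter_arr [simp]:
  assumes "X \<in> Ob C" "A \<in> Ob C" "f \<in> Ar C" "Dom C f = X" "Cod C f = X \<boxplus> A"
  shows "Iter X A f \<in> Ar C" "Dom C (Iter X A f) = X" "Cod C (Iter X A f) = A"
  using iter_hom[of X A f] assms by (simp_all add: hom_iff)

text \<open>The diagonal law splits the loop on \<open>X + Y\<close> into an inner loop fed back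
  only through \<open>X\<close> and an outer one fed back only through \<open>Y\<close>.
  Dinaturality along the injections shrinks these to the loops \<open>u\<close> on \<open>X\<close>
  and \<open>w\<close> on \<open>Y\<close>, and single unfoldings recover the remaining
  rows.\<close>

lemma iter_bekic:
  assumes X: "X \<in> Ob C" "Y \<in> Ob C" "B \<in> Ob C"
    and f: "f \<in> hom C (X \<boxplus> Y) ((X \<boxplus> Y) \<boxplus> B)"
  defines "g \<equiv> f \<cdot> \<beta> X Y B"
  defines "u \<equiv> Iter X (Y \<boxplus> B) (\<iota>\<^sub>1 X Y \<cdot> g)"
  defines "w \<equiv> Iter Y B (\<iota>\<^sub>2 X Y \<cdot> g \<cdot> copair C u (\<one> (Y \<boxplus> B)))"
  shows "Iter (X \<boxplus> Y) B f = copair C (u \<cdot> copair C w (\<one> B)) w"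
proof -
  let ?Z = "X \<boxplus> Y"
  note [simp] = X homD[OF f]
  have g [simp]: "g \<in> Ar C" "Dom C g = ?Z" "Cod C g = X \<boxplus> (Y \<boxplus> B)"
    unfolding g_def by simp_all
  have u [simp]: "u \<in> Ar C" "Dom C u = X" "Cod C u = Y \<boxplus> B"
    unfolding u_def by simp_all
  \<comment> \<open>\<open>G\<close> will turn out to be the inner iterate: one pass of
    \<open>g\<close> whose \<open>X\<close>-output is finished by \<open>u\<close>.\<close>
  define G where "G = g \<cdot> copair C u (\<one> (Y \<boxplus> B))"
  have G [simp]: "G \<in> Ar C" "Dom C G = ?Z" "Cod C G = Y \<boxplus> B"
    unfolding G_def by simp_all
  \<comment> \<open>In \<open>K\<close> only the \<open>X\<close>-output returns to the loop; the
    \<open>Y\<close>-output counts as an exit.\<close>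
  define K where "K = g \<cdot> (\<iota>\<^sub>1 X Y \<oplus> \<one> (Y \<boxplus> B))"
  have K [simp]: "K \<in> Ar C" "Dom C K = ?Z" "Cod C K = ?Z \<boxplus> (Y \<boxplus> B)"
    unfolding K_def by simp_all
  \<comment> \<open>\<open>F\<close> puts the exit \<open>Y\<close> on a second copy of the feedback
    object. Merging the two copies gives back \<open>f\<close>, so the diagonal law applies.\<close>
  define F where "F = K \<cdot> (\<one> ?Z \<oplus> (\<iota>\<^sub>2 X Y \<oplus> \<one> B))"
  have F [simp]: "F \<in> Ar C" "Dom C F = ?Z" "Cod C F = ?Z \<boxplus> (?Z \<boxplus> B)"
    unfolding F_def by simp_all
  have "F \<cdot> \<alpha> ?Z ?Z B \<cdot> (\<nabla> ?Z \<oplus> \<one> B) = f"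
    unfolding F_def K_def g_def by simp
  then have "Iter ?Z B f = Iter ?Z B (Iter ?Z (?Z \<boxplus> B) F)"
    using iter_diagonal[of ?Z B F] by (simp add: hom_iff)
  also have "Iter ?Z (?Z \<boxplus> B) F = Iter ?Z (Y \<boxplus> B) K \<cdot> (\<iota>\<^sub>2 X Y \<oplus> \<one> B)"
    unfolding F_def by (rule iter_naturality) (simp_all add: hom_iff)
  \<comment> \<open>Dinaturality along the first injection identifies the \<open>X\<close>-row of
    \<open>Iter K\<close> with \<open>u\<close>. As \<open>K\<close> feeds back through
    \<open>X\<close> alone, one unfolding then yields \<open>G\<close>.\<close>
  also have "Iter ?Z (Y \<boxplus> B) K = G"
  proof -
    have "\<iota>\<^sub>1 X Y \<cdot> Iter ?Z (Y \<boxplus> B) K = u"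
      unfolding u_def K_def by (rule iter_dinaturality[symmetric]) (simp_all add: hom_iff)
    moreover have "K \<cdot> copair C t (\<one> (Y \<boxplus> B)) = g \<cdot> copair C (\<iota>\<^sub>1 X Y \<cdot> t) (\<one> (Y \<boxplus> B))"
      if "t \<in> hom C ?Z (Y \<boxplus> B)" for t
      unfolding K_def using homD[OF that] by simp
    ultimately show ?thesis
      using iter_iteration[of ?Z "Y \<boxplus> B" K] by (simp add: hom_iff G_def)
  qed
  finally have h: "Iter ?Z B f = Iter ?Z B (G \<cdot> (\<iota>\<^sub>2 X Y \<oplus> \<one> B))" .
  define H where "H = G \<cdot> (\<iota>\<^sub>2 X Y \<oplus> \<one> B)"
  have H [simp]: "H \<in> Ar C" "Dom C H = ?Z" "Cod C H = ?Z \<boxplus> B"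
    unfolding H_def by simp_all
  \<comment> \<open>The outer loop is treated likewise: dinaturality along the second injection,
    then one unfolding.\<close>
  have "w = Iter Y B (\<iota>\<^sub>2 X Y \<cdot> G)"
    unfolding w_def G_def by simp
  also have "\<dots> = \<iota>\<^sub>2 X Y \<cdot> Iter ?Z B H"
    unfolding H_def by (rule iter_dinaturality) (simp_all add: hom_iff)
  finally have w: "w = \<iota>\<^sub>2 X Y \<cdot> Iter ?Z B H" .
  have "Iter ?Z B H = H \<cdot> copair C (Iter ?Z B H) (\<one> B)"
    by (rule iter_iteration[symmetric]) (simp_all add: hom_iff)
  also have "H \<cdot> copair C t (\<one> B) = G \<cdot> copair C (\<iota>\<^sub>2 X Y \<cdot> t) (\<one> B)" if "t \<in> hom C ?Z B" for t
    unfolding H_def using homD[OF that] by simp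
  then have "H \<cdot> copair C (Iter ?Z B H) (\<one> B) = G \<cdot> copair C w (\<one> B)"
    by (simp add: w hom_iff)
  finally have "Iter ?Z B H = G \<cdot> copair C w (\<one> B)" .
  moreover have "\<iota>\<^sub>1 X Y \<cdot> G = u"
    using iter_iteration[of X "Y \<boxplus> B" "\<iota>\<^sub>1 X Y \<cdot> g"] by (simp add: hom_iff G_def u_def)
  then have "G = copair C u (\<iota>\<^sub>2 X Y \<cdot> G)"
    using copair_eta[of G X Y] by simp
  moreover have "\<iota>\<^sub>2 X Y \<cdot> G \<cdot> copair C w (\<one> B) = w"
    using iter_iteration[of Y B "\<iota>\<^sub>2 X Y \<cdot> G"] \<open>w = Iter Y B (\<iota>\<^sub>2 X Y \<cdot> G)\<close>
    by (simp add: hom_iff del: comp_assoc_arr)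
  moreover have "w \<in> hom C Y B"
    by (simp add: w hom_iff)
  ultimately have "Iter ?Z B H = copair C (u \<cdot> copair C w (\<one> B)) w"
    using copair_comp[of u "\<iota>\<^sub>2 X Y \<cdot> G" "copair C w (\<one> B)"] by (simp add: hom_iff)
  then show ?thesis
    using h by (simp add: H_def)
qed

lemma trace_of_iter_eq:
  assumes "X \<in> Ob C" "A \<in> Ob C" "B \<in> Ob C" "f \<in> Ar C" "Dom C f = X \<boxplus> A" "Cod C f = X \<boxplus> B"
  shows "trace_of_iter C Iter X A B f = \<iota>\<^sub>2 X A \<cdot> (f \<cdot> copair C (Iter X B (\<iota>\<^sub>1 X A \<cdot> f)) (\<one> B))"
  using assms by (simp add: trace_of_iter_def trace_dom_def hom_iff)

text \<open>Tightening and superposing come from naturality, sliding from dinaturality and vanishing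
  from the Bekic identity. For yanking, the loop body is the second injection, so one unfolding
  gives the identity.\<close>

theorem trace_operator_trace_of_iter: "trace_operator C (trace_of_iter C Iter)"
proof
  fix X A B f
  assume "\<not> trace_dom C X A B f"
  then show "trace_of_iter C Iter X A B f = undefined"
    by (simp add: trace_of_iter_def)
next
  fix X A B f
  assume "X \<in> Ob C" "A \<in> Ob C" "B \<in> Ob C" "f \<in> hom C (X \<boxplus> A) (X \<boxplus> B)"
  then show "trace_of_iter C Iter X A B f \<in> hom C A B"
    by (simp add: trace_of_iter_eq hom_iff)
next
  fix X A B A' B' f g h
  assume X: "X \<in> Ob C" and f: "f \<in> hom C (X \<boxplus> A) (X \<boxplus> B)"
    and g: "g \<in> hom C A' A" and h: "h \<in> hom C B B'"
  note [simp] = X homD[OF f] homD[OF g] homD[OF h]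
  have "Iter X B' (\<iota>\<^sub>1 X A \<cdot> f \<cdot> (\<one> X \<oplus> h)) = Iter X B (\<iota>\<^sub>1 X A \<cdot> f) \<cdot> h"
    by (rule iter_naturality) (simp_all add: hom_iff)
  then show "trace_of_iter C Iter X A' B' ((\<one> X \<oplus> g) \<cdot> f \<cdot> (\<one> X \<oplus> h)) =
      g \<cdot> trace_of_iter C Iter X A B f \<cdot> h"
    by (simp add: trace_of_iter_eq)
next
  fix A B f X X' k
  assume X: "A \<in> Ob C" "B \<in> Ob C" and f: "f \<in> hom C (X \<boxplus> A) (X' \<boxplus> B)"
    and k: "k \<in> hom C X' X"
  note [simp] = X homD[OF f] homD[OF k]
  have "Iter X' B (k \<cdot> (\<iota>\<^sub>1 X A \<cdot> f)) = k \<cdot> Iter X B (\<iota>\<^sub>1 X A \<cdot> f \<cdot> (k \<oplus> \<one> B))"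
    by (rule iter_dinaturality) (simp_all add: hom_iff)
  then show "trace_of_iter C Iter X A B (f \<cdot> (k \<oplus> \<one> B)) =
      trace_of_iter C Iter X' A B ((k \<oplus> \<one> A) \<cdot> f)"
    by (simp add: trace_of_iter_eq)
next
  fix X Y A B f
  assume X: "X \<in> Ob C" "Y \<in> Ob C" "A \<in> Ob C" "B \<in> Ob C"
    and f: "f \<in> hom C ((X \<boxplus> Y) \<boxplus> A) ((X \<boxplus> Y) \<boxplus> B)"
  note [simp] = X homD[OF f]
  define g where "g = \<iota>\<^sub>1 (X \<boxplus> Y) A \<cdot> f \<cdot> \<beta> X Y B"
  define r where "r = \<iota>\<^sub>2 (X \<boxplus> Y) A \<cdot> f \<cdot> \<beta> X Y B"
  have [simp]: "g \<in> Ar C" "Dom C g = X \<boxplus> Y" "Cod C g = X \<boxplus> (Y \<boxplus> B)"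
    "r \<in> Ar C" "Dom C r = A" "Cod C r = X \<boxplus> (Y \<boxplus> B)"
    unfolding g_def r_def by simp_all
  define u where "u = Iter X (Y \<boxplus> B) (\<iota>\<^sub>1 X Y \<cdot> g)"
  have [simp]: "u \<in> Ar C" "Dom C u = X" "Cod C u = Y \<boxplus> B"
    unfolding u_def by simp_all
  let ?W = "copair C u (\<one> (Y \<boxplus> B))"
  define w where "w = Iter Y B (\<iota>\<^sub>2 X Y \<cdot> g \<cdot> ?W)"
  have [simp]: "w \<in> Ar C" "Dom C w = Y" "Cod C w = B"
    unfolding w_def by simp_all
  have "Iter (X \<boxplus> Y) B (\<iota>\<^sub>1 (X \<boxplus> Y) A \<cdot> f) = copair C (u \<cdot> copair C w (\<one> B)) w"
    unfolding w_def u_def g_def by (rule iter_bekic) (simp_all add: hom_iff)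
  then have "trace_of_iter C Iter (X \<boxplus> Y) A B f =
      \<iota>\<^sub>2 (X \<boxplus> Y) A \<cdot> (f \<cdot> copair C (copair C (u \<cdot> copair C w (\<one> B)) w) (\<one> B))"
    by (simp add: trace_of_iter_eq)
  \<comment> \<open>The Bekic solution factors as the inner solution \<open>?W\<close> followed by
    the outer one, which is the order in which the nested traces close the loops.\<close>
  also have "\<dots> = r \<cdot> (?W \<cdot> copair C w (\<one> B))"
    unfolding r_def by simp
  also have "\<dots> = trace_of_iter C Iter Y A B (copair C (\<iota>\<^sub>2 X Y \<cdot> g \<cdot> ?W) (r \<cdot> ?W))"
    by (simp add: trace_of_iter_eq w_def)
  also have "copair C (\<iota>\<^sub>2 X Y \<cdot> g \<cdot> ?W) (r \<cdot> ?W) =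
      trace_of_iter C Iter X (Y \<boxplus> A) (Y \<boxplus> B)
        (copair C (\<iota>\<^sub>1 X Y \<cdot> g) (copair C (\<iota>\<^sub>2 X Y \<cdot> g) r))"
    by (simp add: trace_of_iter_eq u_def)
  also have "copair C (\<iota>\<^sub>1 X Y \<cdot> g) (copair C (\<iota>\<^sub>2 X Y \<cdot> g) r) = \<alpha> X Y A \<cdot> f \<cdot> \<beta> X Y B"
    unfolding g_def r_def by simp
  finally show "trace_of_iter C Iter (X \<boxplus> Y) A B f = trace_of_iter C Iter Y A B
      (trace_of_iter C Iter X (Y \<boxplus> A) (Y \<boxplus> B) (\<alpha> X Y A \<cdot> f \<cdot> \<beta> X Y B))" .
next
  fix X A B D E f g
  assume X: "X \<in> Ob C" "A \<in> Ob C" "B \<in> Ob C" and f: "f \<in> hom C (X \<boxplus> A) (X \<boxplus> B)"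
    and g: "g \<in> hom C D E"
  note [simp] = X homD[OF f] homD[OF g]
  have "Iter X (B \<boxplus> E) (\<iota>\<^sub>1 X A \<cdot> f \<cdot> (\<one> X \<oplus> \<iota>\<^sub>1 B E)) = Iter X B (\<iota>\<^sub>1 X A \<cdot> f) \<cdot> \<iota>\<^sub>1 B E"
    by (rule iter_naturality) (simp_all add: hom_iff)
  then show "trace_of_iter C Iter X (A \<boxplus> D) (B \<boxplus> E) (\<alpha> X A D \<cdot> (f \<oplus> g) \<cdot> \<beta> X B E) =
      trace_of_iter C Iter X A B f \<oplus> g"
    by (simp add: trace_of_iter_eq)
next
  fix X
  assume [simp]: "X \<in> Ob C"
  show "trace_of_iter C Iter X X X (\<sigma> X X) = \<one> X"
    using iter_iteration[of X X "\<iota>\<^sub>2 X X"] by (simp add: trace_of_iter_eq hom_iff)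
qed

text \<open>Tracing \<open>\<nabla> X \<cdot> f\<close> gives the loop \<open>f\<close> unfolded
  once, which the iteration axiom absorbs.\<close>

lemma iter_of_trace_of_iter: "iter_of_trace C (trace_of_iter C Iter) = Iter"
proof (intro ext)
  fix X B f
  show "iter_of_trace C (trace_of_iter C Iter) X B f = Iter X B f"
  proof (cases "iter_dom C X B f")
    case True
    then have "X \<in> Ob C" "B \<in> Ob C" "f \<in> hom C X (X \<boxplus> B)"
      by (simp_all add: iter_dom_def)
    then show ?thesis
      using iter_iteration[of X B f] True by (simp add: iter_of_trace_def trace_of_iter_eq hom_iff)
  qed (simp add: iter_of_trace_def iter_undefined)
qed

end

section \<open>Iteration operators from traces\<close>

context trace_operator
begin

lemma Tr_arr [simp]:
  assumes "X \<in> Ob C" "A \<in> Ob C" "B \<in> Ob C" "f \<in> Ar C" "Dom C f = X \<boxplus> A" "Cod C f = X \<boxplus> B"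
  shows "Tr X A B f \<in> Ar C" "Dom C (Tr X A B f) = A" "Cod C (Tr X A B f) = B"
  using trace_hom[of X A B f] assms by (simp_all add: hom_iff)

text \<open>Here and in the next two lemmas a traced map is given by its rows: \<open>p\<close> is
  the body of the loop and \<open>q\<close> its entry. Tightening on the input side touches
  \<open>q\<close> alone.\<close>

lemma Tr_comp_left:
  assumes "p \<in> hom C X (X \<boxplus> B)" "q \<in> hom C A (X \<boxplus> B)" "g \<in> hom C A' A" "B \<in> Ob C"
  shows "Tr X A' B (copair C p (g \<cdot> q)) = g \<cdot> Tr X A B (copair C p q)"
  using trace_tightening[of X "copair C p q" A B g A' "\<one> B" B] assms(1-3)[THEN homD] assms(4)
  by (simp add: hom_iff)

lemma Tr_comp_right:
  assumes "p \<in> hom C X (X \<boxplus> B)" "q \<in> hom C A (X \<boxplus> B)" "h \<in> hom C B B'"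
  shows "Tr X A B' (copair C (p \<cdot> (\<one> X \<oplus> h)) (q \<cdot> (\<one> X \<oplus> h))) = Tr X A B (copair C p q) \<cdot> h"
  using trace_tightening[of X "copair C p q" A B "\<one> A" A h B'] assms[THEN homD]
  by (simp add: hom_iff)

lemma Tr_slide:
  assumes "p \<in> hom C X (X' \<boxplus> B)" "q \<in> hom C A (X' \<boxplus> B)" "k \<in> hom C X' X" "B \<in> Ob C"
  shows "Tr X A B (copair C (p \<cdot> (k \<oplus> \<one> B)) (q \<cdot> (k \<oplus> \<one> B))) = Tr X' A B (copair C (k \<cdot> p) q)"
  using trace_sliding[of A B "copair C p q" X X' k] assms(1-3)[THEN homD] assms(4)
  by (simp add: hom_iff)

text \<open>Superposing with \<open>\<one> B\<close> adds a wire that certainly bypasses the loop.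
  Entering by this wire gives \<open>\<iota>\<^sub>2 B B\<close> whatever the trace in question is,
  and merging the outputs by \<open>\<nabla> B\<close> turns the bypass into the entry
  \<open>\<iota>\<^sub>2 X B\<close>.\<close>

lemma Tr_inj2:
  assumes p: "p \<in> hom C X (X \<boxplus> B)" and [simp]: "B \<in> Ob C"
  shows "Tr X B B (copair C p (\<iota>\<^sub>2 X B)) = \<one> B"
proof -
  note [simp] = homD[OF p]
  define p' where "p' = p \<cdot> (\<one> X \<oplus> \<iota>\<^sub>1 B B)"
  have p' [simp]: "p' \<in> Ar C" "Dom C p' = X" "Cod C p' = X \<boxplus> (B \<boxplus> B)"
    unfolding p'_def by simp_all
  have "Tr X (B \<boxplus> B) (B \<boxplus> B) (copair C p' (\<iota>\<^sub>2 X (B \<boxplus> B))) =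
      Tr X B B (copair C p (\<iota>\<^sub>2 X B)) \<oplus> \<one> B"
    using trace_superposing[of X B B "copair C p (\<iota>\<^sub>2 X B)" "\<one> B" B B]
    by (simp add: hom_iff p'_def)
  then have "Tr X B (B \<boxplus> B) (copair C p' (\<iota>\<^sub>2 B B \<cdot> \<iota>\<^sub>2 X (B \<boxplus> B))) = \<iota>\<^sub>2 B B"
    by (subst Tr_comp_left[where A = "B \<boxplus> B"]) (simp_all add: hom_iff)
  then show ?thesis
    using Tr_comp_right[of p' X "B \<boxplus> B" "\<iota>\<^sub>2 B B \<cdot> \<iota>\<^sub>2 X (B \<boxplus> B)" B "\<nabla> B" B]
    by (simp add: hom_iff) (simp add: p'_def)
qed

text \<open>Tightening pulls out \<open>q\<close> and leaves the identity of \<open>X + B\<close> as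
  entry. That trace is determined by its two rows, and \<open>Tr_inj2\<close> computes the
  second.\<close>

lemma Tr_factor:
  assumes p: "p \<in> hom C X (X \<boxplus> B)" and q: "q \<in> hom C A (X \<boxplus> B)" and [simp]: "B \<in> Ob C"
  shows "Tr X A B (copair C p q) = q \<cdot> copair C (Tr X X B (copair C p (\<iota>\<^sub>1 X B))) (\<one> B)"
proof -
  note [simp] = homD[OF p] homD[OF q]
  let ?T = "Tr X (X \<boxplus> B) B (copair C p (\<one> (X \<boxplus> B)))"
  have "?T = copair C (\<iota>\<^sub>1 X B \<cdot> ?T) (\<iota>\<^sub>2 X B \<cdot> ?T)"
    by (rule copair_eta[symmetric]) simp_all
  also have "\<iota>\<^sub>1 X B \<cdot> ?T = Tr X X B (copair C p (\<iota>\<^sub>1 X B))"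
    by (subst Tr_comp_left[symmetric]) (simp_all add: hom_iff)
  also have "\<iota>\<^sub>2 X B \<cdot> ?T = \<one> B"
    by (subst Tr_comp_left[symmetric, where A' = B]) (simp_all add: hom_iff Tr_inj2)
  finally show ?thesis
    using Tr_comp_left[of p X B "\<one> (X \<boxplus> B)" "X \<boxplus> B" q A] by (simp add: hom_iff)
qed

text \<open>Sliding along \<open>p : X \<rightarrow> X + B\<close> itself exposes one unfolding of the loop, at the price of a
  second feedback wire \<open>B\<close>, which vanishing and yanking remove.\<close>

lemma Tr_fixpoint:
  assumes p: "p \<in> hom C X (X \<boxplus> B)" and [simp]: "B \<in> Ob C"
  shows "Tr X X B (copair C p (\<iota>\<^sub>1 X B)) =
    p \<cdot> copair C (Tr X X B (copair C p (\<iota>\<^sub>1 X B))) (\<one> B)"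
proof -
  note [simp] = homD[OF p]
  define t where "t = Tr X X B (copair C p (\<iota>\<^sub>1 X B))"
  have t [simp]: "t \<in> Ar C" "Dom C t = X" "Cod C t = B"
    unfolding t_def by simp_all
  \<comment> \<open>\<open>M\<close> is left once \<open>p\<close> has been slid around the loop and
    its leading copy pulled out. An exit of \<open>p\<close> now passes through the feedback wire
    \<open>B\<close> before it leaves.\<close>
  define M where "M = copair C (p \<oplus> \<one> B) (\<iota>\<^sub>1 (X \<boxplus> B) B)"
  have M [simp]: "M \<in> Ar C" "Dom C M = (X \<boxplus> B) \<boxplus> (X \<boxplus> B)" "Cod C M = (X \<boxplus> B) \<boxplus> B"
    unfolding M_def by simp_all
  define p' where "p' = p \<cdot> (\<one> X \<oplus> \<iota>\<^sub>1 B B)"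
  have p' [simp]: "p' \<in> Ar C" "Dom C p' = X" "Cod C p' = X \<boxplus> (B \<boxplus> B)"
    unfolding p'_def by simp_all
  \<comment> \<open>The entry of the inner loop on \<open>X\<close>: the fed-back \<open>B\<close>
    exits, the input \<open>X\<close> enters the loop, and the input \<open>B\<close> goes to the
    feedback wire.\<close>
  define q' where "q' = copair C (\<iota>\<^sub>2 B B \<cdot> \<iota>\<^sub>2 X (B \<boxplus> B))
    (copair C (\<iota>\<^sub>1 X (B \<boxplus> B)) (\<iota>\<^sub>1 B B \<cdot> \<iota>\<^sub>2 X (B \<boxplus> B)))"
  have q' [simp]: "q' \<in> Ar C" "Dom C q' = B \<boxplus> (X \<boxplus> B)" "Cod C q' = X \<boxplus> (B \<boxplus> B)"
    unfolding q'_def by simp_all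
  have t': "Tr X X (B \<boxplus> B) (copair C p' (\<iota>\<^sub>1 X (B \<boxplus> B))) = t \<cdot> \<iota>\<^sub>1 B B"
    using Tr_comp_right[of p X B "\<iota>\<^sub>1 X B" X "\<iota>\<^sub>1 B B" "B \<boxplus> B"]
    by (simp add: hom_iff t_def p'_def)
  have "t = Tr (X \<boxplus> B) X B (copair C (p \<oplus> \<one> B) (p \<cdot> \<iota>\<^sub>1 (X \<boxplus> B) B))"
    using Tr_slide[of "\<one> (X \<boxplus> B)" "X \<boxplus> B" X B "\<iota>\<^sub>1 X B" X p]
    by (simp add: hom_iff t_def)
  also have "\<dots> = p \<cdot> Tr (X \<boxplus> B) (X \<boxplus> B) B M"
    unfolding M_def by (rule Tr_comp_left) (simp_all add: hom_iff)
  also have "Tr (X \<boxplus> B) (X \<boxplus> B) B M =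
      Tr B (X \<boxplus> B) B (Tr X (B \<boxplus> (X \<boxplus> B)) (B \<boxplus> B) (\<alpha> X B (X \<boxplus> B) \<cdot> M \<cdot> \<beta> X B B))"
    by (rule trace_vanishing) (simp_all add: hom_iff)
  also have "\<alpha> X B (X \<boxplus> B) \<cdot> M \<cdot> \<beta> X B B = copair C p' q'"
    unfolding M_def p'_def q'_def by simp
  also have "Tr X (B \<boxplus> (X \<boxplus> B)) (B \<boxplus> B) (copair C p' q') =
      copair C (\<iota>\<^sub>2 B B) (copair C (t \<cdot> \<iota>\<^sub>1 B B) (\<iota>\<^sub>1 B B))"
    by (subst Tr_factor) (simp_all add: hom_iff t', simp add: q'_def)
  \<comment> \<open>After factoring, the loop on \<open>B\<close> has body
    \<open>\<iota>\<^sub>2 B B\<close> and entry \<open>\<iota>\<^sub>1 B B\<close>. This is the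
    symmetry, so yanking applies.\<close>
  also have "Tr B (X \<boxplus> B) B \<dots> = copair C t (\<one> B)"
    using trace_yanking[of B] by (subst Tr_factor) (simp_all add: hom_iff)
  finally show ?thesis
    by (simp add: t_def)
qed

text \<open>Factoring the left side and unfolding the right side give the same composite.\<close>

lemma Tr_codiag:
  assumes p: "p \<in> hom C X (X \<boxplus> B)" and B: "B \<in> Ob C"
  shows "Tr X X B (copair C p p) = Tr X X B (copair C p (\<iota>\<^sub>1 X B))"
  using Tr_factor[OF p p B] Tr_fixpoint[OF p B] by simp

lemma iter_of_trace_eq:
  assumes "X \<in> Ob C" "B \<in> Ob C" "f \<in> Ar C" "Dom C f = X" "Cod C f = X \<boxplus> B"
  shows "iter_of_trace C Tr X B f = Tr X X B (copair C f f)"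
  using assms by (simp add: iter_of_trace_def iter_dom_def hom_iff)

text \<open>The iteration axiom is \<open>Tr_fixpoint\<close>, and naturality is tightening.
  Dinaturality combines tightening with sliding, and the diagonal law combines sliding along
  \<open>\<nabla> X\<close> with vanishing.\<close>

theorem parametrized_iteration_operator_iter_of_trace:
  "parametrized_iteration_operator C (iter_of_trace C Tr)"
proof
  fix X A f
  assume "\<not> iter_dom C X A f"
  then show "iter_of_trace C Tr X A f = undefined"
    by (simp add: iter_of_trace_def)
next
  fix X A f
  assume "X \<in> Ob C" "A \<in> Ob C" "f \<in> hom C X (X \<boxplus> A)"
  then show "iter_of_trace C Tr X A f \<in> hom C X A"
    by (simp add: iter_of_trace_eq hom_iff)
next
  fix X A f
  assume [simp]: "X \<in> Ob C" "A \<in> Ob C" and f: "f \<in> hom C X (X \<boxplus> A)"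
  show "f \<cdot> copair C (iter_of_trace C Tr X A f) (\<one> A) = iter_of_trace C Tr X A f"
    using homD[OF f] Tr_fixpoint[OF f] Tr_codiag[OF f] by (simp add: iter_of_trace_eq)
next
  fix X A' A f h
  assume [simp]: "X \<in> Ob C" and f: "f \<in> hom C X (X \<boxplus> A')" and h: "h \<in> hom C A' A"
  show "iter_of_trace C Tr X A (f \<cdot> (\<one> X \<oplus> h)) = iter_of_trace C Tr X A' f \<cdot> h"
    using homD[OF f] homD[OF h] Tr_comp_right[OF f f h] by (simp add: iter_of_trace_eq)
next
  fix A f X' X k
  assume A [simp]: "A \<in> Ob C" and f: "f \<in> hom C X' (X \<boxplus> A)" and k: "k \<in> hom C X X'"
  note [simp] = homD[OF f] homD[OF k]
  have "Tr X X A (copair C (k \<cdot> f) (k \<cdot> f)) = k \<cdot> Tr X X' A (copair C (k \<cdot> f) f)"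
    by (rule Tr_comp_left) (simp_all add: hom_iff)
  then show "iter_of_trace C Tr X A (k \<cdot> f) = k \<cdot> iter_of_trace C Tr X' A (f \<cdot> (k \<oplus> \<one> A))"
    using Tr_slide[OF f f k A] by (simp add: iter_of_trace_eq)
next
  fix X A f
  assume [simp]: "X \<in> Ob C" "A \<in> Ob C" and f: "f \<in> hom C X (X \<boxplus> (X \<boxplus> A))"
  note [simp] = homD[OF f]
  define p where "p = f \<cdot> \<alpha> X X A"
  have p [simp]: "p \<in> Ar C" "Dom C p = X" "Cod C p = (X \<boxplus> X) \<boxplus> A"
    unfolding p_def by simp_all
  \<comment> \<open>Sliding the codiagonal to the front doubles the feedback wire, so that vanishing
    can split the trace in two.\<close>
  have "Tr X X A (copair C (p \<cdot> (\<nabla> X \<oplus> \<one> A)) (p \<cdot> (\<nabla> X \<oplus> \<one> A))) =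
      Tr (X \<boxplus> X) X A (copair C (\<nabla> X \<cdot> p) p)"
    by (rule Tr_slide) (simp_all add: hom_iff)
  also have "\<dots> = Tr X X A (Tr X (X \<boxplus> X) (X \<boxplus> A)
      (\<alpha> X X X \<cdot> copair C (\<nabla> X \<cdot> p) p \<cdot> \<beta> X X A))"
    by (rule trace_vanishing) (simp_all add: hom_iff)
  also have "\<alpha> X X X \<cdot> copair C (\<nabla> X \<cdot> p) p \<cdot> \<beta> X X A = copair C f (\<nabla> X \<cdot> f)"
    unfolding p_def by simp
  also have "Tr X (X \<boxplus> X) (X \<boxplus> A) (copair C f (\<nabla> X \<cdot> f)) =
      \<nabla> X \<cdot> Tr X X (X \<boxplus> A) (copair C f f)"
    by (rule Tr_comp_left) (simp_all add: hom_iff)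
  finally have "Tr X X A (copair C (p \<cdot> (\<nabla> X \<oplus> \<one> A)) (p \<cdot> (\<nabla> X \<oplus> \<one> A))) =
      Tr X X A (\<nabla> X \<cdot> Tr X X (X \<boxplus> A) (copair C f f))" .
  then show "iter_of_trace C Tr X A (iter_of_trace C Tr X (X \<boxplus> A) f) =
      iter_of_trace C Tr X A (f \<cdot> \<alpha> X X A \<cdot> (\<nabla> X \<oplus> \<one> A))"
    unfolding p_def by (simp add: iter_of_trace_eq)
qed

lemma trace_of_iter_of_trace: "trace_of_iter C (iter_of_trace C Tr) = Tr"
proof (intro ext)
  fix X A B f
  show "trace_of_iter C (iter_of_trace C Tr) X A B f = Tr X A B f"
  proof (cases "trace_dom C X A B f")
    case True
    then have X [simp]: "X \<in> Ob C" "A \<in> Ob C" "B \<in> Ob C" and f: "f \<in> hom C (X \<boxplus> A) (X \<boxplus> B)"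
      by (simp_all add: trace_dom_def)
    note [simp] = homD[OF f]
    have p: "\<iota>\<^sub>1 X A \<cdot> f \<in> hom C X (X \<boxplus> B)" and q: "\<iota>\<^sub>2 X A \<cdot> f \<in> hom C A (X \<boxplus> B)"
      by (simp_all add: hom_iff)
    show ?thesis
      using True Tr_factor[OF p q] Tr_codiag[OF p]
      by (simp add: trace_of_iter_def iter_of_trace_eq)
  qed (simp add: trace_of_iter_def trace_undefined)
qed

end

section \<open>Restriction categories with coproducts and zeroes\<close>

context restriction_category
begin

lemma rst_arr [simp]:
  assumes "f \<in> Ar C"
  shows "\<rho> f \<in> Ar C" "Dom C (\<rho> f) = Dom C f" "Cod C (\<rho> f) = Dom C f"
  using rst_hom[of f "Dom C f" "Cod C f"] assms by (simp_all add: hom_iff)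

lemma rst_self [simp]: "f \<in> Ar C \<Longrightarrow> \<rho> f \<cdot> f = f"
  by (rule rst_comp_self) (simp add: hom_iff)

lemma rst_commute_arr:
  "f \<in> Ar C \<Longrightarrow> g \<in> Ar C \<Longrightarrow> Dom C f = Dom C g \<Longrightarrow> \<rho> f \<cdot> \<rho> g = \<rho> g \<cdot> \<rho> f"
  by (rule rst_commute) (auto simp add: hom_iff)

lemma rst_rst_comp_arr:
  "f \<in> Ar C \<Longrightarrow> g \<in> Ar C \<Longrightarrow> Dom C f = Dom C g \<Longrightarrow> \<rho> (\<rho> g \<cdot> f) = \<rho> g \<cdot> \<rho> f"
  by (rule rst_rst_comp) (auto simp add: hom_iff)

lemma comp_rst_arr:
  "f \<in> Ar C \<Longrightarrow> g \<in> Ar C \<Longrightarrow> Cod C f = Dom C g \<Longrightarrow> f \<cdot> \<rho> g = \<rho> (f \<cdot> g) \<cdot> f"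
  by (rule comp_rst) (auto simp add: hom_iff)

lemma rst_ident [simp]: "A \<in> Ob C \<Longrightarrow> \<rho> (\<one> A) = \<one> A"
  using rst_self[of "\<one> A"] comp_ident[of "\<rho> (\<one> A)" A] by simp

lemma rst_rst [simp]: "f \<in> Ar C \<Longrightarrow> \<rho> (\<rho> f) = \<rho> f"
  using rst_rst_comp_arr[of "\<one> (Dom C f)" f] by simp

lemma rst_comp_rst:
  assumes "f \<in> Ar C" "g \<in> Ar C" "Cod C f = Dom C g"
  shows "\<rho> (f \<cdot> \<rho> g) = \<rho> (f \<cdot> g)"
proof -
  have "\<rho> (f \<cdot> \<rho> g) = \<rho> (f \<cdot> g) \<cdot> \<rho> f"
    using assms by (subst comp_rst_arr) (simp_all add: rst_rst_comp_arr)
  also have "\<dots> = \<rho> f \<cdot> \<rho> (f \<cdot> g)"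
    using assms by (simp add: rst_commute_arr)
  also have "\<dots> = \<rho> (\<rho> f \<cdot> (f \<cdot> g))"
    using assms by (simp add: rst_rst_comp_arr)
  also have "\<rho> f \<cdot> (f \<cdot> g) = f \<cdot> g"
    using assms by (simp flip: comp_assoc_arr)
  finally show ?thesis .
qed

lemma rst_comp_total:
  assumes "f \<in> Ar C" "g \<in> Ar C" "Cod C f = Dom C g" "\<rho> g = \<one> (Dom C g)"
  shows "\<rho> (f \<cdot> g) = \<rho> f"
  using rst_comp_rst[of f g] assms by simp

lemma restr_leD:
  assumes "f \<preceq> g"
  shows "f \<in> Ar C" "g \<in> Ar C" "Dom C f = Dom C g" "Cod C f = Cod C g" "\<rho> f \<cdot> g = f"
  using assms by (auto simp: restr_le_def parallel_def)

lemma rst_comp_of_restr_le: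
  assumes "f \<preceq> g"
  shows "\<rho> g \<cdot> f = f"
proof -
  note [simp] = restr_leD[OF assms]
  have "\<rho> g \<cdot> f = \<rho> g \<cdot> \<rho> f \<cdot> g"
    by simp
  also have "\<dots> = \<rho> f \<cdot> \<rho> g \<cdot> g"
    by (simp add: rst_commute_arr del: comp_assoc_arr)
  finally show ?thesis
    by simp
qed

lemma restr_le_antisym:
  assumes "f \<preceq> g" "g \<preceq> f"
  shows "f = g"
  using rst_comp_of_restr_le[OF assms(1)] restr_leD[OF assms(2)] by simp

lemma join_eqI:
  assumes "is_join C f g j"
  shows "f \<squnion> g = j"
  unfolding join_def by (rule the_equality) (use assms restr_le_antisym in \<open>auto simp: is_join_def\<close>)

lemma join_commute: "f \<squnion> g = g \<squnion> f"
  unfolding join_def by (rule arg_cong[where f = The]) (auto simp: is_join_def)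

end

context restriction_category_with_zeroes
begin

lemma zero_arr [simp]:
  assumes "A \<in> Ob C" "B \<in> Ob C"
  shows "\<zero> A B \<in> Ar C" "Dom C (\<zero> A B) = A" "Cod C (\<zero> A B) = B"
  using zero_hom[OF assms] by (simp_all add: hom_iff)

lemma comp_zero_arr [simp]:
  "f \<in> Ar C \<Longrightarrow> Cod C f = B \<Longrightarrow> D \<in> Ob C \<Longrightarrow> f \<cdot> \<zero> B D = \<zero> (Dom C f) D"
  by (rule comp_zero) (simp_all add: hom_iff)

lemma zero_comp_arr [simp]:
  "f \<in> Ar C \<Longrightarrow> Dom C f = A \<Longrightarrow> D \<in> Ob C \<Longrightarrow> \<zero> D A \<cdot> f = \<zero> D (Cod C f)"
  by (rule zero_comp) (simp_all add: hom_iff)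

lemmas rst_zero_arr [simp] = rst_zero

end

context cocartesian_restriction_category
begin

lemma rst_inj [simp]:
  assumes "A \<in> Ob C" "B \<in> Ob C"
  shows "\<rho> (\<iota>\<^sub>1 A B) = \<one> A" "\<rho> (\<iota>\<^sub>2 A B) = \<one> B"
  using cinj_total[of "[A, B]" 0] cinj_total[of "[A, B]" 1] inj1_arr[OF assms] inj2_arr[OF assms] assms
  by (simp_all add: total_def inj1_def inj2_def)

text \<open>On each injection, \<open>comp_rst\<close> moves the restriction in front of the
  injection.\<close>

lemma rst_copair [simp]:
  assumes "f \<in> Ar C" "g \<in> Ar C" "Cod C f = Cod C g"
  shows "\<rho> (copair C f g) = copair C (\<rho> f \<cdot> \<iota>\<^sub>1 (Dom C f) (Dom C g)) (\<rho> g \<cdot> \<iota>\<^sub>2 (Dom C f) (Dom C g))"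
  by (rule copair_eqI[of _ _ "Dom C f" "Dom C g"]) (use assms in \<open>auto simp: comp_rst_arr\<close>)

end

section \<open>Decisions in extensive restriction categories\<close>

context extensive_restriction_category
begin

text \<open>The quasi-projections in copair form, so that the copair rules compute with them;
  \<open>quasi_proj_eq\<close> makes the identification.\<close>

abbreviation proj1 :: "'o \<Rightarrow> 'o \<Rightarrow> 'a" where
  "proj1 A B \<equiv> copair C (\<one> A) (\<zero> B A)"

abbreviation proj2 :: "'o \<Rightarrow> 'o \<Rightarrow> 'a" where
  "proj2 A B \<equiv> copair C (\<zero> A B) (\<one> B)"

lemma copair_zero [simp]:
  assumes "A \<in> Ob C" "B \<in> Ob C" "D \<in> Ob C"
  shows "copair C (\<zero> A D) (\<zero> B D) = \<zero> (A \<boxplus> B) D"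
  by (rule copair_eqI[of _ _ A B]) (use assms in simp_all)

lemma quasi_proj_eq [simp]:
  assumes [simp]: "A \<in> Ob C" "B \<in> Ob C"
  shows "quasi_proj C [A, B] 0 = proj1 A B" "quasi_proj C [A, B] (Suc 0) = proj2 A B"
proof -
  have *: "cinj C [A, B] 0 = \<iota>\<^sub>1 A B" "cinj C [A, B] (Suc 0) = \<iota>\<^sub>2 A B" "coprod C [A, B] = A \<boxplus> B"
    by (simp_all add: inj1_def inj2_def sum2_def)
  have eta: "q = copair C (\<iota>\<^sub>1 A B \<cdot> q) (\<iota>\<^sub>2 A B \<cdot> q)" if "q \<in> hom C (A \<boxplus> B) D" for q D
    using homD[OF that] by simp
  show "quasi_proj C [A, B] 0 = proj1 A B"
    unfolding quasi_proj_def
  proof (rule the_equality, goal_cases)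
    case 1
    show ?case
      by (auto simp: less_Suc_eq * hom_iff)
  next
    case (2 q)
    then show ?case
      using eta[of q A] by (auto simp: less_Suc_eq *)
  qed
  show "quasi_proj C [A, B] (Suc 0) = proj2 A B"
    unfolding quasi_proj_def
  proof (rule the_equality, goal_cases)
    case 1
    show ?case
      by (auto simp: less_Suc_eq * hom_iff)
  next
    case (2 q)
    then show ?case
      using eta[of q B] by (auto simp: less_Suc_eq *)
  qed
qed

section \<open>Brackets of maps into a binary coproduct\<close>

lemma is_bracket2_iff:
  assumes f: "f \<in> hom C A (B \<boxplus> D)" and [simp]: "B \<in> Ob C" "D \<in> Ob C"
  shows "is_bracket C [B, D] f d \<longleftrightarrow> d \<in> hom C A (A \<boxplus> A) \<and> \<rho> f = d \<cdot> \<nabla> A \<and>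
    d \<cdot> (f \<oplus> f) = f \<cdot> (\<iota>\<^sub>1 B D \<oplus> \<iota>\<^sub>2 B D)"
proof -
  have "replicate 2 z = [z, z]" for z :: 'x
    by (simp add: numeral_2_eq_2)
  moreover have "map (cinj C [B, D]) [0..<2] = [\<iota>\<^sub>1 B D, \<iota>\<^sub>2 B D]"
    by (simp add: numeral_2_eq_2 inj1_def inj2_def)
  ultimately show ?thesis
    using homD[OF f]
    by (simp add: is_bracket_def Let_def sum_map2_def sum2_def codiag2_def numeral_2_eq_2
        del: sum_map2_eq codiag2_eq)
qed

text \<open>The restriction of \<open>proj1\<close> equals \<open>proj1\<close> followed by
  \<open>\<iota>\<^sub>1\<close>, so this is \<open>comp_rst\<close> for \<open>h\<close> and
  \<open>proj1\<close>; the second claim is symmetric. It says that \<open>h\<close>, cut down to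
  where it lands in one summand, is known from its component there.\<close>

lemma rst_proj_comp:
  assumes h: "h \<in> hom C A (B \<boxplus> D)" and [simp]: "B \<in> Ob C" "D \<in> Ob C"
  shows "\<rho> (h \<cdot> proj1 B D) \<cdot> h = h \<cdot> proj1 B D \<cdot> \<iota>\<^sub>1 B D"
    and "\<rho> (h \<cdot> proj2 B D) \<cdot> h = h \<cdot> proj2 B D \<cdot> \<iota>\<^sub>2 B D"
  using homD[OF h] comp_rst_arr[of h "proj1 B D"] comp_rst_arr[of h "proj2 B D"] by simp_all

context
  fixes f d A B D
  assumes f: "f \<in> hom C A (B \<boxplus> D)" and BD: "B \<in> Ob C" "D \<in> Ob C"
    and d: "d \<in> hom C A (A \<boxplus> A)" "\<rho> f = d \<cdot> \<nabla> A" "d \<cdot> (f \<oplus> f) = f \<cdot> (\<iota>\<^sub>1 B D \<oplus> \<iota>\<^sub>2 B D)"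
begin

text \<open>The first bracket equation places each component of \<open>d\<close> below
  \<open>\<rho> f\<close>, and the second computes its composite with \<open>f\<close>. Together
  they determine the component.\<close>

lemma bracket_proj: "d \<cdot> proj1 A A = \<rho> (f \<cdot> proj1 B D)" "d \<cdot> proj2 A A = \<rho> (f \<cdot> proj2 B D)"
proof -
  note [simp] = BD homD[OF f] homD[OF d(1)]
  \<comment> \<open>A map \<open>z\<close> below \<open>\<rho> f\<close> is a restriction
    idempotent, namely the restriction of \<open>z \<cdot> f\<close>; the total \<open>i\<close>
    does not change that restriction.\<close>
  have *: "z = \<rho> z'" if z: "z = \<rho> z \<cdot> \<rho> f" "z \<cdot> f = z' \<cdot> i" and [simp]: "z \<in> hom C A A"
    "z' \<in> hom C A Z" "i \<in> hom C Z (B \<boxplus> D)" "\<rho> i = \<one> Z" for z z' i Z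
  proof -
    note [simp] = that(3-5)[THEN homD]
    have "z = \<rho> (\<rho> z \<cdot> f)"
      using z(1) by (simp add: rst_rst_comp_arr)
    also have "\<rho> z \<cdot> f = \<rho> z \<cdot> \<rho> f \<cdot> f"
      by simp
    also have "\<dots> = z' \<cdot> i"
      using z by (simp del: comp_assoc_arr)
    finally show ?thesis
      by (simp add: rst_comp_total)
  qed
  have "d \<cdot> proj1 A A = \<rho> (d \<cdot> proj1 A A) \<cdot> d \<cdot> \<nabla> A"
    by (subst rst_proj_comp[OF d(1)]) simp_all
  moreover have "d \<cdot> proj1 A A \<cdot> f = f \<cdot> proj1 B D \<cdot> \<iota>\<^sub>1 B D"
    using arg_cong[OF d(3), of "\<lambda>z. z \<cdot> proj1 (B \<boxplus> D) (B \<boxplus> D)"] by simp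
  ultimately show "d \<cdot> proj1 A A = \<rho> (f \<cdot> proj1 B D)"
    by (intro *[where i = "\<iota>\<^sub>1 B D" and Z = B]) (simp_all add: d(2) hom_iff)
  have "d \<cdot> proj2 A A = \<rho> (d \<cdot> proj2 A A) \<cdot> d \<cdot> \<nabla> A"
    by (subst rst_proj_comp[OF d(1)]) simp_all
  moreover have "d \<cdot> proj2 A A \<cdot> f = f \<cdot> proj2 B D \<cdot> \<iota>\<^sub>2 B D"
    using arg_cong[OF d(3), of "\<lambda>z. z \<cdot> proj2 (B \<boxplus> D) (B \<boxplus> D)"] by simp
  ultimately show "d \<cdot> proj2 A A = \<rho> (f \<cdot> proj2 B D)"
    by (intro *[where i = "\<iota>\<^sub>2 B D" and Z = D]) (simp_all add: d(2) hom_iff)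
qed

text \<open>The second bracket equation recovers \<open>f\<close> as \<open>d\<close> followed by
  the sum \<open>?S\<close> of the components of \<open>f\<close>. Moving the restriction of
  \<open>?S\<close> across \<open>d\<close> therefore gives \<open>\<rho> f \<cdot> d\<close>, and
  \<open>\<rho> f = \<rho> d\<close> because the codiagonal is total.\<close>

lemma bracket_cover: "d \<cdot> (\<rho> (f \<cdot> proj1 B D) \<oplus> \<rho> (f \<cdot> proj2 B D)) = d"
proof -
  note [simp] = BD homD[OF f] homD[OF d(1)]
  let ?S = "(f \<cdot> proj1 B D) \<oplus> (f \<cdot> proj2 B D)"
  have S: "d \<cdot> ?S = f"
    using arg_cong[OF d(3), of "\<lambda>z. z \<cdot> (proj1 B D \<oplus> proj2 B D)"] by simp
  have "d \<cdot> (\<rho> (f \<cdot> proj1 B D) \<oplus> \<rho> (f \<cdot> proj2 B D)) = d \<cdot> \<rho> ?S"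
    using rst_comp_total[of "f \<cdot> proj1 B D" "\<iota>\<^sub>1 B D"] rst_comp_total[of "f \<cdot> proj2 B D" "\<iota>\<^sub>2 B D"]
    by simp
  also have "\<dots> = \<rho> (d \<cdot> ?S) \<cdot> d"
    by (rule comp_rst_arr) simp_all
  also have "\<dots> = \<rho> (d \<cdot> \<nabla> A) \<cdot> d"
    unfolding S using arg_cong[OF d(2), of \<rho>] by (simp del: codiag2_eq)
  also have "\<dots> = d"
    by (subst rst_comp_total) simp_all
  finally show ?thesis .
qed

end

lemma ex_bracket2:
  assumes f: "f \<in> hom C A (B \<boxplus> D)" and BD: "B \<in> Ob C" "D \<in> Ob C"
  obtains d where "d \<in> hom C A (A \<boxplus> A)" "\<rho> f = d \<cdot> \<nabla> A"
    "d \<cdot> (f \<oplus> f) = f \<cdot> (\<iota>\<^sub>1 B D \<oplus> \<iota>\<^sub>2 B D)"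
proof -
  obtain d where "is_bracket C [B, D] f d"
    using extensive[of "[B, D]" f A] f BD by (auto simp: sum2_def)
  then show thesis
    using that is_bracket2_iff[OF f BD] by blast
qed

text \<open>By antisymmetry it suffices to prove \<open>f \<preceq> g\<close>. The bracket of
  \<open>f\<close> splits its domain into two pieces, and on each piece \<open>rst_proj_comp\<close>
  expresses both maps by the component they share.\<close>

lemma proj_jointly_monic:
  assumes f: "f \<in> hom C A (B \<boxplus> D)" and g: "g \<in> hom C A (B \<boxplus> D)"
    and BD [simp]: "B \<in> Ob C" "D \<in> Ob C"
    and eq: "f \<cdot> proj1 B D = g \<cdot> proj1 B D" "f \<cdot> proj2 B D = g \<cdot> proj2 B D"
  shows "f = g"
proof -
  have le: "f \<preceq> g" if f: "f \<in> hom C A (B \<boxplus> D)" and g: "g \<in> hom C A (B \<boxplus> D)"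
    and eq: "f \<cdot> proj1 B D = g \<cdot> proj1 B D" "f \<cdot> proj2 B D = g \<cdot> proj2 B D" for f g
  proof -
    note [simp] = homD[OF f] homD[OF g]
    obtain d where d: "d \<in> hom C A (A \<boxplus> A)" "\<rho> f = d \<cdot> \<nabla> A"
      "d \<cdot> (f \<oplus> f) = f \<cdot> (\<iota>\<^sub>1 B D \<oplus> \<iota>\<^sub>2 B D)"
      by (rule ex_bracket2[OF f BD])
    note [simp] = homD[OF d(1)]
    define e where "e = \<rho> (f \<cdot> proj1 B D)"
    define e' where "e' = \<rho> (f \<cdot> proj2 B D)"
    have [simp]: "e \<in> Ar C" "Dom C e = A" "Cod C e = A" "e' \<in> Ar C" "Dom C e' = A" "Cod C e' = A"
      by (simp_all add: e_def e'_def)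
    have cover: "d \<cdot> (e \<oplus> e') = d"
      unfolding e_def e'_def by (rule bracket_cover[OF f BD d])
    have ef: "e \<cdot> f = e \<cdot> g" "e' \<cdot> f = e' \<cdot> g"
      unfolding e_def e'_def using rst_proj_comp[OF f BD] rst_proj_comp[OF g BD]
      by (simp_all only: eq)
    \<comment> \<open>By the cover, a map after \<open>d \<cdot> \<nabla> A\<close> matters only
      through its restrictions to \<open>e\<close> and \<open>e'\<close>.\<close>
    have *: "d \<cdot> \<nabla> A \<cdot> z = d \<cdot> copair C (e \<cdot> z) (e' \<cdot> z)" if "z \<in> hom C A (B \<boxplus> D)" for z
      using arg_cong[OF cover, of "\<lambda>d. d \<cdot> \<nabla> A \<cdot> z"] homD[OF that] by simp
    have "\<rho> f \<cdot> g = \<rho> f \<cdot> f"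
      unfolding d(2) using *[OF f] *[OF g] by (simp only: ef)
    then show ?thesis
      by (simp add: restr_le_def parallel_def)
  qed
  show ?thesis
    by (rule restr_le_antisym) (rule le f g eq eq[symmetric])+
qed

text \<open>By \<open>bracket_proj\<close> the bracket of \<open>d\<close> has the restrictions of
  the components of \<open>d\<close> as its own components. Joint monicity makes the bracket unique
  and reduces \<open>\<langle>d\<rangle> = d\<close> to equality of components.\<close>

lemma is_decision2_iff:
  assumes d: "d \<in> hom C A (A \<boxplus> A)"
  shows "is_decision C 2 A d \<longleftrightarrow>
    d \<cdot> proj1 A A = \<rho> (d \<cdot> proj1 A A) \<and> d \<cdot> proj2 A A = \<rho> (d \<cdot> proj2 A A)"
proof -
  have A [simp]: "A \<in> Ob C"
    using homD[OF d] by simp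
  obtain b where b: "b \<in> hom C A (A \<boxplus> A)" "\<rho> d = b \<cdot> \<nabla> A"
    "b \<cdot> (d \<oplus> d) = d \<cdot> (\<iota>\<^sub>1 A A \<oplus> \<iota>\<^sub>2 A A)"
    by (rule ex_bracket2[OF d A A])
  have "bracket C [A, A] d = b"
    unfolding bracket_def
  proof (rule the_equality)
    show "is_bracket C [A, A] d b"
      unfolding is_bracket2_iff[OF d A A] using b by simp
    fix b'
    assume "is_bracket C [A, A] d b'"
    then have b': "b' \<in> hom C A (A \<boxplus> A)" "\<rho> d = b' \<cdot> \<nabla> A"
      "b' \<cdot> (d \<oplus> d) = d \<cdot> (\<iota>\<^sub>1 A A \<oplus> \<iota>\<^sub>2 A A)"
      unfolding is_bracket2_iff[OF d A A] by simp_all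
    show "b' = b"
      by (rule proj_jointly_monic[OF b'(1) b(1) A A])
        (simp_all only: bracket_proj[OF d A A b] bracket_proj[OF d A A b'])
  qed
  moreover have "replicate 2 A = [A, A]"
    by (simp add: numeral_2_eq_2)
  ultimately have "is_decision C 2 A d \<longleftrightarrow> b = d"
    using d by (simp add: is_decision_def sum2_def)
  also have "\<dots> \<longleftrightarrow> d \<cdot> proj1 A A = b \<cdot> proj1 A A \<and> d \<cdot> proj2 A A = b \<cdot> proj2 A A"
    using proj_jointly_monic[OF d b(1) A A] by auto
  finally show ?thesis
    unfolding bracket_proj[OF d A A b] .
qed

text \<open>A map with components \<open>\<rho> f\<close> and \<open>\<rho> g\<close> is a decision
  by \<open>is_decision2_iff\<close>, since \<open>\<rho>\<close> is idempotent.\<close>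

lemma is_separating_decision_iff:
  assumes "f \<in> Ar C" "g \<in> Ar C" "Dom C f = A" "Dom C g = A"
  shows "is_separating_decision C f g d \<longleftrightarrow>
    d \<in> hom C A (A \<boxplus> A) \<and> d \<cdot> proj1 A A = \<rho> f \<and> d \<cdot> proj2 A A = \<rho> g"
proof (cases "d \<in> hom C A (A \<boxplus> A)")
  case True
  have "is_separating_decision C f g d \<longleftrightarrow>
      is_decision C 2 A d \<and> d \<cdot> proj1 A A = \<rho> f \<and> d \<cdot> proj2 A A = \<rho> g"
    using assms dom_ob[of f] by (simp add: is_separating_decision_def)
  moreover have "is_decision C 2 A d" if "d \<cdot> proj1 A A = \<rho> f" "d \<cdot> proj2 A A = \<rho> g"
    unfolding is_decision2_iff[OF True] that using assms by simp
  ultimately show ?thesis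
    using True by blast
next
  case False
  then show ?thesis
    using assms
    by (auto simp: is_separating_decision_def is_decision_def Let_def sum2_def numeral_2_eq_2)
qed

text \<open>The bracket of \<open>h\<close> is the separating decision, by
  \<open>bracket_proj\<close>. Later instances of \<open>perp_d\<close> are produced by exhibiting
  such an \<open>h\<close>.\<close>

lemma perp_d_proj:
  assumes h: "h \<in> hom C A (B \<boxplus> D)" and [simp]: "B \<in> Ob C" "D \<in> Ob C"
  shows "perp_d C (h \<cdot> proj1 B D) (h \<cdot> proj2 B D)"
proof -
  note [simp] = homD[OF h]
  obtain d where d: "d \<in> hom C A (A \<boxplus> A)" "\<rho> h = d \<cdot> \<nabla> A"
    "d \<cdot> (h \<oplus> h) = h \<cdot> (\<iota>\<^sub>1 B D \<oplus> \<iota>\<^sub>2 B D)"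
    by (rule ex_bracket2[OF h]) simp_all
  then have "is_separating_decision C (h \<cdot> proj1 B D) (h \<cdot> proj2 B D) d"
    using bracket_proj[OF h _ _ d] by (subst is_separating_decision_iff[where A = A]) simp_all
  then show ?thesis
    by (auto simp: perp_d_def)
qed

text \<open>Conversely, following the decision by \<open>f \<oplus> g\<close> gives components
  \<open>\<rho> f \<cdot> f = f\<close> and \<open>\<rho> g \<cdot> g = g\<close>. With
  \<open>pairing_proj\<close>, separated pairs and maps into \<open>B + D\<close> become the same
  data.\<close>

lemma separating_decision_pairing:
  assumes f: "f \<in> hom C A B" and g: "g \<in> hom C A D" and perp: "perp_d C f g"
  shows "\<langle>f|g\<rangle> \<in> hom C A (A \<boxplus> A)" "\<langle>f|g\<rangle> \<cdot> proj1 A A = \<rho> f" "\<langle>f|g\<rangle> \<cdot> proj2 A A = \<rho> g"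
    "\<langle>f|g\<rangle> \<cdot> (f \<oplus> g) \<in> hom C A (B \<boxplus> D)"
    "\<langle>f|g\<rangle> \<cdot> (f \<oplus> g) \<cdot> proj1 B D = f" "\<langle>f|g\<rangle> \<cdot> (f \<oplus> g) \<cdot> proj2 B D = g"
proof -
  note [simp] = homD[OF f] homD[OF g]
  note iff = is_separating_decision_iff[of f g A]
  obtain d where d: "is_separating_decision C f g d"
    using perp by (auto simp: perp_d_def)
  have "\<langle>f|g\<rangle> = d"
    unfolding separating_decision_def
    by (rule the_equality[where a = d])
      (use d iff proj_jointly_monic[of _ A A A d] in auto)
  with d have *: "\<langle>f|g\<rangle> \<in> hom C A (A \<boxplus> A)" "\<langle>f|g\<rangle> \<cdot> proj1 A A = \<rho> f" "\<langle>f|g\<rangle> \<cdot> proj2 A A = \<rho> g"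
    using iff by simp_all
  then show "\<langle>f|g\<rangle> \<in> hom C A (A \<boxplus> A)" "\<langle>f|g\<rangle> \<cdot> proj1 A A = \<rho> f" "\<langle>f|g\<rangle> \<cdot> proj2 A A = \<rho> g"
    by simp_all
  note [simp] = homD[OF *(1)]
  show "\<langle>f|g\<rangle> \<cdot> (f \<oplus> g) \<in> hom C A (B \<boxplus> D)"
    by (simp add: hom_iff)
  show "\<langle>f|g\<rangle> \<cdot> (f \<oplus> g) \<cdot> proj1 B D = f"
    using arg_cong[OF *(2), of "\<lambda>z. z \<cdot> f"] by simp
  show "\<langle>f|g\<rangle> \<cdot> (f \<oplus> g) \<cdot> proj2 B D = g"
    using arg_cong[OF *(3), of "\<lambda>z. z \<cdot> g"] by simp
qed

lemma perp_dE:
  assumes f: "f \<in> hom C A B" and g: "g \<in> hom C A D" and perp: "perp_d C f g"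
  obtains h where "h \<in> hom C A (B \<boxplus> D)" "f = h \<cdot> proj1 B D" "g = h \<cdot> proj2 B D"
  using separating_decision_pairing[OF assms] by metis

lemma pairing_proj:
  assumes h: "h \<in> hom C A (B \<boxplus> D)" and BD [simp]: "B \<in> Ob C" "D \<in> Ob C"
  shows "\<langle>h \<cdot> proj1 B D|h \<cdot> proj2 B D\<rangle> \<cdot> ((h \<cdot> proj1 B D) \<oplus> (h \<cdot> proj2 B D)) = h"
proof -
  have "h \<cdot> proj1 B D \<in> hom C A B" "h \<cdot> proj2 B D \<in> hom C A D"
    using homD[OF h] by (simp_all add: hom_iff)
  note pairing = separating_decision_pairing(4-6)[OF this perp_d_proj[OF h BD]]
  show ?thesis
    by (rule proj_jointly_monic[OF pairing(1) h BD pairing(2,3)])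
qed

section \<open>Joins of separated maps and the interference axioms\<close>

lemma is_join_proj:
  assumes h: "h \<in> hom C A (B \<boxplus> B)" and B [simp]: "B \<in> Ob C"
  shows "is_join C (h \<cdot> proj1 B B) (h \<cdot> proj2 B B) (h \<cdot> \<nabla> B)"
  unfolding is_join_def
proof (intro conjI allI impI)
  note [simp] = homD[OF h]
  have "\<rho> (h \<cdot> proj1 B B) \<cdot> h \<cdot> \<nabla> B = h \<cdot> proj1 B B"
    "\<rho> (h \<cdot> proj2 B B) \<cdot> h \<cdot> \<nabla> B = h \<cdot> proj2 B B"
    by (subst rst_proj_comp[OF h B B], simp)+
  then show "h \<cdot> proj1 B B \<preceq> h \<cdot> \<nabla> B" "h \<cdot> proj2 B B \<preceq> h \<cdot> \<nabla> B"
    by (simp_all add: restr_le_def parallel_def)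
  fix u
  assume u: "h \<cdot> proj1 B B \<preceq> u \<and> h \<cdot> proj2 B B \<preceq> u"
  have [simp]: "u \<in> Ar C" "Dom C u = A" "Cod C u = B"
    using u restr_leD[of "h \<cdot> proj1 B B" u] by simp_all
  have u': "\<rho> (h \<cdot> proj1 B B) \<cdot> u = h \<cdot> proj1 B B" "\<rho> (h \<cdot> proj2 B B) \<cdot> u = h \<cdot> proj2 B B"
    using u restr_leD(5) by blast+
  obtain d where d: "d \<in> hom C A (A \<boxplus> A)" "\<rho> h = d \<cdot> \<nabla> A"
    "d \<cdot> (h \<oplus> h) = h \<cdot> (\<iota>\<^sub>1 B B \<oplus> \<iota>\<^sub>2 B B)"
    by (rule ex_bracket2[OF h]) simp_all
  note [simp] = homD[OF d(1)]
  \<comment> \<open>Applying the upper bound \<open>u\<close> in both branches of the bracket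
    restricts it to the domains of the two components, where it agrees with them. Joint monicity
    then rebuilds \<open>h\<close>.\<close>
  have "d \<cdot> (u \<oplus> u) = h"
  proof (rule proj_jointly_monic[OF _ h B B])
    show "d \<cdot> (u \<oplus> u) \<in> hom C A (B \<boxplus> B)"
      by (simp add: hom_iff)
    show "d \<cdot> (u \<oplus> u) \<cdot> proj1 B B = h \<cdot> proj1 B B"
      using arg_cong[OF bracket_proj(1)[OF h B B d], of "\<lambda>z. z \<cdot> u"] unfolding u' by simp
    show "d \<cdot> (u \<oplus> u) \<cdot> proj2 B B = h \<cdot> proj2 B B"
      using arg_cong[OF bracket_proj(2)[OF h B B d], of "\<lambda>z. z \<cdot> u"] unfolding u' by simp
  qed
  then have "d \<cdot> \<nabla> A \<cdot> u = h \<cdot> \<nabla> B"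
    using arg_cong[of _ _ "\<lambda>z. z \<cdot> \<nabla> B"] by fastforce
  moreover have "\<rho> (h \<cdot> \<nabla> B) = d \<cdot> \<nabla> A"
    unfolding d(2)[symmetric] by (rule rst_comp_total) simp_all
  ultimately show "h \<cdot> \<nabla> B \<preceq> u"
    by (simp add: restr_le_def parallel_def)
qed

lemma join_proj:
  assumes "h \<in> hom C A (B \<boxplus> B)" "B \<in> Ob C"
  shows "(h \<cdot> proj1 B B) \<squnion> (h \<cdot> proj2 B B) = h \<cdot> \<nabla> B"
  by (rule join_eqI) (rule is_join_proj[OF assms])

text \<open>A separated pair is replaced by the map it consists of, and each new pair is shown
  separated by writing down a map with those components; for symmetry that map is
  \<open>h \<cdot> \<sigma> B D\<close>.\<close>

sublocale perp_d: interference_relation_with_joins C "perp_d C"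
proof
  fix f g
  assume "perp_d C f g"
  then show "f \<in> Ar C \<and> g \<in> Ar C \<and> Dom C f = Dom C g"
    by (simp add: perp_d_def)
next
  fix A B
  assume "A \<in> Ob C" "B \<in> Ob C"
  then show "perp_d C (\<one> A) (\<zero> A B)"
    using perp_d_proj[of "\<iota>\<^sub>1 A B" A A B] by (simp add: hom_iff)
next
  fix f g
  assume perp: "perp_d C f g"
  then obtain A B D where f: "f \<in> hom C A B" and g: "g \<in> hom C A D"
    by (simp add: perp_d_def hom_iff)
  note [simp] = homD[OF f] homD[OF g]
  obtain h where h: "h \<in> hom C A (B \<boxplus> D)" "f = h \<cdot> proj1 B D" "g = h \<cdot> proj2 B D"
    by (rule perp_dE[OF f g perp])
  show "perp_d C g f"
    using perp_d_proj[of "h \<cdot> \<sigma> B D" A D B] homD[OF h(1)] unfolding h(2,3) by (simp add: hom_iff)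
next
  fix f
  assume perp: "perp_d C f f"
  then obtain A B where f: "f \<in> hom C A B"
    by (simp add: perp_d_def hom_iff)
  note [simp] = homD[OF f]
  obtain h where h: "h \<in> hom C A (B \<boxplus> B)" "f = h \<cdot> proj1 B B" "f = h \<cdot> proj2 B B"
    by (rule perp_dE[OF f f perp])
  \<comment> \<open>Both sides equal \<open>\<rho> f \<cdot> h\<close>. Following them by
    \<open>proj1\<close> leaves \<open>f\<close> on the left and zero on the right.\<close>
  have "f \<cdot> \<iota>\<^sub>1 B B = f \<cdot> \<iota>\<^sub>2 B B"
    using rst_proj_comp[OF h(1)] unfolding h(2,3)[symmetric] by simp
  then have "f \<cdot> \<iota>\<^sub>1 B B \<cdot> proj1 B B = f \<cdot> \<iota>\<^sub>2 B B \<cdot> proj1 B B"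
    by simp
  then show "f = \<zero> (Dom C f) (Cod C f)"
    by simp
next
  fix f' g' f g
  assume perp: "perp_d C f' g'" and le: "f \<preceq> f'" "g \<preceq> g'"
  note [simp] = restr_leD[OF le(1)] restr_leD[OF le(2)]
  define A B D where "A = Dom C f'" "B = Cod C f'" "D = Cod C g'"
  have [simp]: "Dom C g' = Dom C f'"
    using perp by (simp add: perp_d_def)
  have f': "f' \<in> hom C A B" "g' \<in> hom C A D" and [simp]: "B \<in> Ob C" "D \<in> Ob C"
    by (simp_all add: A_B_D_def hom_iff)
  note [simp] = A_B_D_def[symmetric]
  note d = separating_decision_pairing(1-3)[OF f' perp]
  note [simp] = homD[OF d(1)]
  \<comment> \<open>The decision for the larger pair serves again, since
    \<open>\<rho> f' \<cdot> f = f\<close> and \<open>\<rho> g' \<cdot> g = g\<close>.\<close>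
  have "\<langle>f'|g'\<rangle> \<cdot> (f \<oplus> g) \<cdot> proj1 B D = f" "\<langle>f'|g'\<rangle> \<cdot> (f \<oplus> g) \<cdot> proj2 B D = g"
    using arg_cong[OF d(2), of "\<lambda>z. z \<cdot> f"] arg_cong[OF d(3), of "\<lambda>z. z \<cdot> g"]
      rst_comp_of_restr_le[OF le(1)] rst_comp_of_restr_le[OF le(2)] by simp_all
  then show "perp_d C f g"
    using perp_d_proj[of "\<langle>f'|g'\<rangle> \<cdot> (f \<oplus> g)" A B D] by (simp add: hom_iff)
next
  fix f A B g D h A' k B' k' D'
  assume f: "f \<in> hom C A B" and g: "g \<in> hom C A D" and perp: "perp_d C f g"
    and hk: "h \<in> hom C A' A" "k \<in> hom C B B'" "k' \<in> hom C D D'"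
  note [simp] = homD[OF f] homD[OF g] hk[THEN homD]
  obtain p where p: "p \<in> hom C A (B \<boxplus> D)" "f = p \<cdot> proj1 B D" "g = p \<cdot> proj2 B D"
    by (rule perp_dE[OF f g perp])
  show "perp_d C (h \<cdot> f \<cdot> k) (h \<cdot> g \<cdot> k')"
    using perp_d_proj[of "h \<cdot> p \<cdot> (k \<oplus> k')" A' B' D'] homD[OF p(1)] unfolding p(2,3)
    by (simp add: hom_iff)
next
  fix f g
  assume perp: "perp_d C f g"
  then obtain A B D where f: "f \<in> hom C A B" and g: "g \<in> hom C A D"
    by (simp add: perp_d_def hom_iff)
  note [simp] = homD[OF f] homD[OF g]
  note d = separating_decision_pairing(1-3)[OF f g perp]
  show "perp_d C (\<rho> f) (\<rho> g)"
    using perp_d_proj[OF d(1)] unfolding d(2,3) by simp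
next
  fix f g A B
  assume f: "f \<in> hom C A B" and g: "g \<in> hom C A B" and perp: "perp_d C f g"
  obtain h where h: "h \<in> hom C A (B \<boxplus> B)" "f = h \<cdot> proj1 B B" "g = h \<cdot> proj2 B B"
    by (rule perp_dE[OF f g perp])
  show "\<exists>j. is_join C f g j"
    unfolding h(2,3) using is_join_proj[OF h(1)] homD[OF f] by blast
next
  fix f A B g h A'
  assume f: "f \<in> hom C A B" and g: "g \<in> hom C A B" and perp: "perp_d C f g"
    and h: "h \<in> hom C A' A"
  note [simp] = homD[OF f] homD[OF g] homD[OF h]
  obtain p where p: "p \<in> hom C A (B \<boxplus> B)" "f = p \<cdot> proj1 B B" "g = p \<cdot> proj2 B B"
    by (rule perp_dE[OF f g perp])
  note [simp] = homD[OF p(1)]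
  show "h \<cdot> (f \<squnion> g) = (h \<cdot> f) \<squnion> (h \<cdot> g)"
    using join_proj[OF p(1)] join_proj[of "h \<cdot> p" A' B] unfolding p(2,3) by (simp add: hom_iff)
qed

end

section \<open>Kleene wands and iteration operators\<close>

context extensive_restriction_category
begin

lemma wand_dom_proj:
  assumes "h \<in> hom C X (X \<boxplus> A)" "X \<in> Ob C" "A \<in> Ob C"
  shows "wand_dom C (perp_d C) (h \<cdot> proj1 X A) (h \<cdot> proj2 X A)"
  unfolding wand_dom_def using perp_d_proj[OF assms] homD[OF assms(1)] assms(2,3)
  by (intro exI[of _ X] exI[of _ A]) (simp add: hom_iff)

text \<open>By \<open>pairing_proj\<close>, the pairing formed inside \<open>wand_of_iter\<close> is
  \<open>h\<close> itself. This carries iteration axioms over to wands.\<close>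

lemma wand_of_iter_proj:
  assumes "h \<in> hom C X (X \<boxplus> A)" "X \<in> Ob C" "A \<in> Ob C"
  shows "wand_of_iter C Iter (h \<cdot> proj1 X A) (h \<cdot> proj2 X A) = Iter X A h"
  using wand_dom_proj[OF assms] pairing_proj[OF assms] homD[OF assms(1)] assms(2,3)
  by (simp add: wand_of_iter_def del: sum_map2_eq)

lemma iter_of_wand_eq:
  assumes "h \<in> hom C X (X \<boxplus> A)" "X \<in> Ob C" "A \<in> Ob C"
  shows "iter_of_wand C wand X A h = wand (h \<cdot> proj1 X A) (h \<cdot> proj2 X A)"
  using assms by (simp add: iter_of_wand_def iter_dom_def)

lemma wand_domE:
  assumes "wand_dom C (perp_d C) f g"
  obtains h X A where "X \<in> Ob C" "A \<in> Ob C" "h \<in> hom C X (X \<boxplus> A)"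
    "f = h \<cdot> proj1 X A" "g = h \<cdot> proj2 X A"
  using assms unfolding wand_dom_def by (metis homD perp_dE)

theorem kleene_wand_wand_of_iter:
  assumes "parametrized_iteration_operator C Iter"
  shows "kleene_wand C (perp_d C) (wand_of_iter C Iter)"
proof -
  interpret parametrized_iteration_operator C Iter by fact
  show ?thesis
  proof
    fix f g
    assume "\<not> wand_dom C (perp_d C) f g"
    then show "wand_of_iter C Iter f g = undefined"
      by (simp add: wand_of_iter_def)
  next
    fix f X g A
    assume f: "f \<in> hom C X X" and g: "g \<in> hom C X A" and perp: "perp_d C f g"
    have X: "X \<in> Ob C" "A \<in> Ob C"
      using homD[OF g] by simp_all
    obtain h where h: "h \<in> hom C X (X \<boxplus> A)" "f = h \<cdot> proj1 X A" "g = h \<cdot> proj2 X A"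
      by (rule perp_dE[OF f g perp])
    show "wand_of_iter C Iter f g \<in> hom C X A"
      unfolding h(2,3) wand_of_iter_proj[OF h(1) X] by (rule iter_hom[OF X h(1)])
  next
    fix f X g A
    assume f: "f \<in> hom C X X" and g: "g \<in> hom C X A" and perp: "perp_d C f g"
    have X [simp]: "X \<in> Ob C" "A \<in> Ob C"
      using homD[OF g] by simp_all
    obtain h where h: "h \<in> hom C X (X \<boxplus> A)" "f = h \<cdot> proj1 X A" "g = h \<cdot> proj2 X A"
      by (rule perp_dE[OF f g perp])
    define w where "w = Iter X A h"
    note [simp] = homD[OF h(1)] homD[OF iter_hom[OF X h(1)], folded w_def]
    \<comment> \<open>The two joined maps are the components of
      \<open>h \<cdot> (w \<oplus> \<one> A)\<close>, so their join is that map followed by the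
      codiagonal.\<close>
    have "f \<cdot> w \<squnion> g = h \<cdot> copair C w (\<one> A)"
      using join_proj[of "h \<cdot> (w \<oplus> \<one> A)" X A] unfolding h(2,3) by (simp add: hom_iff)
    also have "\<dots> = w"
      unfolding w_def by (rule iter_iteration[OF X h(1)])
    finally show "g \<squnion> f \<cdot> wand_of_iter C Iter f g = wand_of_iter C Iter f g"
      using wand_of_iter_proj[OF h(1) X, of Iter]
      unfolding h(2,3)[symmetric] w_def[symmetric] by (simp add: join_commute)
  next
    fix f X g A h B
    assume f: "f \<in> hom C X X" and g: "g \<in> hom C X A" and perp: "perp_d C f g"
      and h: "h \<in> hom C A B"
    note [simp] = homD[OF f] homD[OF h]
    obtain p where p: "p \<in> hom C X (X \<boxplus> A)" "f = p \<cdot> proj1 X A" "g = p \<cdot> proj2 X A"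
      by (rule perp_dE[OF f g perp])
    note [simp] = homD[OF p(1)]
    have "wand_of_iter C Iter f (g \<cdot> h) = Iter X B (p \<cdot> (\<one> X \<oplus> h))"
      using wand_of_iter_proj[of "p \<cdot> (\<one> X \<oplus> h)" X B Iter] unfolding p(2,3) by (simp add: hom_iff)
    then show "wand_of_iter C Iter f g \<cdot> h = wand_of_iter C Iter f (g \<cdot> h)"
      using wand_of_iter_proj[OF p(1), of Iter] iter_naturality[OF _ p(1) h] unfolding p(2,3)
      by simp
  next
    fix f X Y g A k
    assume f: "f \<in> hom C X Y" and g: "g \<in> hom C X A" and k: "k \<in> hom C Y X"
      and perp: "perp_d C f g"
    have A: "A \<in> Ob C"
      using homD[OF g] by simp
    note [simp] = homD[OF k] A
    obtain p where p: "p \<in> hom C X (Y \<boxplus> A)" "f = p \<cdot> proj1 Y A" "g = p \<cdot> proj2 Y A"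
      by (rule perp_dE[OF f g perp])
    note [simp] = homD[OF p(1)]
    have "wand_of_iter C Iter (k \<cdot> f) (k \<cdot> g) = Iter Y A (k \<cdot> p)"
      using wand_of_iter_proj[of "k \<cdot> p" Y A Iter] unfolding p(2,3) by (simp add: hom_iff)
    also have "\<dots> = k \<cdot> Iter X A (p \<cdot> (k \<oplus> \<one> A))"
      by (rule iter_dinaturality[OF A p(1) k])
    also have "Iter X A (p \<cdot> (k \<oplus> \<one> A)) = wand_of_iter C Iter (f \<cdot> k) g"
      using wand_of_iter_proj[of "p \<cdot> (k \<oplus> \<one> A)" X A Iter] unfolding p(2,3) by (simp add: hom_iff)
    finally show "wand_of_iter C Iter (k \<cdot> f) (k \<cdot> g) = k \<cdot> wand_of_iter C Iter (f \<cdot> k) g" .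
  next
    fix f X f' g A
    assume f: "f \<in> hom C X X" and f': "f' \<in> hom C X X" and g: "g \<in> hom C X A"
      and perp: "perp_d C f f'" "perp_d C (f \<squnion> f') g"
    have X [simp]: "X \<in> Ob C" "A \<in> Ob C"
      using homD[OF g] by simp_all
    obtain P where P: "P \<in> hom C X (X \<boxplus> X)" "f = P \<cdot> proj1 X X" "f' = P \<cdot> proj2 X X"
      by (rule perp_dE[OF f f' perp(1)])
    define j where "j = f \<squnion> f'"
    have j_eq: "j = P \<cdot> \<nabla> X"
      unfolding j_def P(2,3) by (rule join_proj[OF P(1) X(1)])
    have j: "j \<in> hom C X X"
      unfolding j_eq using homD[OF P(1)] by (simp add: hom_iff)
    have le: "f \<preceq> j" "f' \<preceq> j"
      using is_join_proj[OF P(1) X(1)] unfolding P(2,3) j_eq is_join_def by blast+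
    note [simp] = homD[OF P(1)] homD[OF f] homD[OF f'] homD[OF g] homD[OF j]
    have "perp_d C j g"
      using perp(2) by (simp add: j_def)
    note d = separating_decision_pairing(1-3)[OF j g this]
    \<comment> \<open>\<open>d\<close> has components \<open>\<rho> j\<close> and \<open>g\<close>:
      it keeps its argument where \<open>j\<close> is defined, ready for a further split into
      \<open>f\<close> and \<open>f'\<close>.\<close>
    define d where "d = \<langle>j|g\<rangle> \<cdot> (\<one> X \<oplus> g)"
    have [simp]: "d \<in> Ar C" "Dom C d = X" "Cod C d = X \<boxplus> A"
      unfolding d_def using homD[OF d(1)] by simp_all
    have d1: "d \<cdot> proj1 X A = \<rho> j" and d2: "d \<cdot> proj2 X A = g"
      unfolding d_def using homD[OF d(1)] d(2) arg_cong[OF d(3), of "\<lambda>z. z \<cdot> g"] by simp_all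
    have d1': "d \<cdot> copair C z (\<zero> A X) = z" if "z \<preceq> j" for z
    proof -
      note [simp] = restr_leD[OF that]
      show ?thesis
        using arg_cong[OF d1, of "\<lambda>y. y \<cdot> z"] rst_comp_of_restr_le[OF that] by simp
    qed
    have "j \<preceq> j"
      by (simp add: restr_le_def parallel_def)
    note d1'' = d1'[OF this] d1'[OF le(1)] d1'[OF le(2)]
    \<comment> \<open>\<open>F\<close> is the three-way pairing of \<open>f\<close>,
      \<open>f'\<close> and \<open>g\<close>, the map on which the diagonal law is used. Merging its
      two copies of \<open>X\<close> replaces \<open>f\<close> and \<open>f'\<close> by their join
      \<open>j\<close>.\<close>
    define F where "F = d \<cdot> (P \<oplus> \<one> A) \<cdot> \<beta> X X A"
    have F: "F \<in> hom C X (X \<boxplus> (X \<boxplus> A))"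
      unfolding F_def by (simp add: hom_iff)
    note [simp] = homD[OF F]
    have F_eqs: "F \<cdot> proj1 X (X \<boxplus> A) = f" "F \<cdot> proj2 X (X \<boxplus> A) \<cdot> proj1 X A = f'"
      "F \<cdot> proj2 X (X \<boxplus> A) \<cdot> proj2 X A = g"
      unfolding F_def using d1'' d2 by (simp_all flip: P(2,3))
    define G where "G = F \<cdot> \<alpha> X X A \<cdot> (\<nabla> X \<oplus> \<one> A)"
    have G: "G \<in> hom C X (X \<boxplus> A)"
      unfolding G_def by (simp add: hom_iff)
    have "G \<cdot> proj1 X A = j" "G \<cdot> proj2 X A = g"
      unfolding G_def F_def using d1'' d2 by (simp_all add: j_eq)
    then have jg: "wand_of_iter C Iter j g = Iter X A G"
      using wand_of_iter_proj[OF G X, of Iter] by simp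
    have I: "Iter X (X \<boxplus> A) F \<in> hom C X (X \<boxplus> A)"
      by (rule iter_hom) (simp_all add: F)
    \<comment> \<open>Naturality along a quasi-projection discards one exit of \<open>F\<close>. The
      two inner wands are thus the components of a single map
      \<open>Iter X (X \<boxplus> A) F\<close>, hence separated.\<close>
    have "wand_of_iter C Iter f f' = Iter X X (F \<cdot> (\<one> X \<oplus> proj1 X A))"
      using wand_of_iter_proj[of "F \<cdot> (\<one> X \<oplus> proj1 X A)" X X Iter]
      unfolding F_eqs[symmetric] by (simp add: hom_iff)
    also have "\<dots> = Iter X (X \<boxplus> A) F \<cdot> proj1 X A"
      by (rule iter_naturality[OF X(1) F]) (simp add: hom_iff)
    finally have ff': "wand_of_iter C Iter f f' = Iter X (X \<boxplus> A) F \<cdot> proj1 X A" .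
    have "wand_of_iter C Iter f g = Iter X A (F \<cdot> (\<one> X \<oplus> proj2 X A))"
      using wand_of_iter_proj[of "F \<cdot> (\<one> X \<oplus> proj2 X A)" X A Iter]
      unfolding F_eqs[symmetric] by (simp add: hom_iff)
    also have "\<dots> = Iter X (X \<boxplus> A) F \<cdot> proj2 X A"
      by (rule iter_naturality[OF X(1) F]) (simp add: hom_iff)
    finally have fg: "wand_of_iter C Iter f g = Iter X (X \<boxplus> A) F \<cdot> proj2 X A" .
    show "perp_d C (wand_of_iter C Iter f f') (wand_of_iter C Iter f g)"
      unfolding ff' fg by (rule perp_d_proj[OF I X])
    show "wand_of_iter C Iter (f \<squnion> f') g =
        wand_of_iter C Iter (wand_of_iter C Iter f f') (wand_of_iter C Iter f g)"
      unfolding ff' fg wand_of_iter_proj[OF I X] j_def[symmetric] jg G_def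
      by (rule iter_diagonal[OF X F, symmetric])
  qed
qed

text \<open>The components of any map into a binary coproduct are separated, so the wand axioms
  apply to them and translate back axiom by axiom.\<close>

theorem parametrized_iteration_operator_iter_of_wand:
  assumes "kleene_wand C (perp_d C) wand"
  shows "parametrized_iteration_operator C (iter_of_wand C wand)"
proof -
  interpret kleene_wand C "perp_d C" wand by fact
  have proj: "h \<cdot> proj1 X A \<in> hom C Z X" "h \<cdot> proj2 X A \<in> hom C Z A"
    "perp_d C (h \<cdot> proj1 X A) (h \<cdot> proj2 X A)"
    if "h \<in> hom C Z (X \<boxplus> A)" "X \<in> Ob C" "A \<in> Ob C" for h X A Z
    using perp_d_proj[OF that] homD[OF that(1)] that(2,3) by (simp_all add: hom_iff)
  show ?thesis
  proof
    fix X A f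
    assume "\<not> iter_dom C X A f"
    then show "iter_of_wand C wand X A f = undefined"
      by (simp add: iter_of_wand_def)
  next
    fix X A f
    assume X: "X \<in> Ob C" "A \<in> Ob C" and f: "f \<in> hom C X (X \<boxplus> A)"
    show "iter_of_wand C wand X A f \<in> hom C X A"
      unfolding iter_of_wand_eq[OF f X] by (rule wand_hom[OF proj[OF f X]])
  next
    fix X A f
    assume X: "X \<in> Ob C" "A \<in> Ob C" and f: "f \<in> hom C X (X \<boxplus> A)"
    define w where "w = iter_of_wand C wand X A f"
    have w_eq: "w = wand (f \<cdot> proj1 X A) (f \<cdot> proj2 X A)"
      unfolding w_def by (rule iter_of_wand_eq[OF f X])
    have w: "w \<in> hom C X A"
      unfolding w_eq by (rule wand_hom[OF proj[OF f X]])
    note [simp] = X homD[OF f] homD[OF w]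
    have "f \<cdot> copair C w (\<one> A) = f \<cdot> proj2 X A \<squnion> f \<cdot> proj1 X A \<cdot> w"
      using join_proj[of "f \<cdot> (w \<oplus> \<one> A)" X A] by (simp add: hom_iff join_commute)
    also have "\<dots> = w"
      unfolding w_eq by (rule wand_iteration[OF proj[OF f X]])
    finally show "f \<cdot> copair C (iter_of_wand C wand X A f) (\<one> A) = iter_of_wand C wand X A f"
      by (simp add: w_def)
  next
    fix X A' A f h
    assume X: "X \<in> Ob C" and f: "f \<in> hom C X (X \<boxplus> A')" and h: "h \<in> hom C A' A"
    note [simp] = X homD[OF f] homD[OF h]
    have fh: "f \<cdot> (\<one> X \<oplus> h) \<in> hom C X (X \<boxplus> A)"
      by (simp add: hom_iff)
    have "(f \<cdot> (\<one> X \<oplus> h)) \<cdot> proj1 X A = f \<cdot> proj1 X A'"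
      "(f \<cdot> (\<one> X \<oplus> h)) \<cdot> proj2 X A = f \<cdot> proj2 X A' \<cdot> h"
      by simp_all
    then show "iter_of_wand C wand X A (f \<cdot> (\<one> X \<oplus> h)) = iter_of_wand C wand X A' f \<cdot> h"
      using wand_naturality[OF proj[OF f] h] iter_of_wand_eq[OF f] iter_of_wand_eq[OF fh]
      by (simp del: comp_assoc_arr sum_map2_eq)
  next
    fix A f X' X k
    assume A: "A \<in> Ob C" and f: "f \<in> hom C X' (X \<boxplus> A)" and k: "k \<in> hom C X X'"
    note [simp] = A homD[OF f] homD[OF k]
    have kf: "k \<cdot> f \<in> hom C X (X \<boxplus> A)" and fk: "f \<cdot> (k \<oplus> \<one> A) \<in> hom C X' (X' \<boxplus> A)"
      by (simp_all add: hom_iff)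
    have eqs: "k \<cdot> f \<cdot> proj1 X A = k \<cdot> (f \<cdot> proj1 X A)" "k \<cdot> f \<cdot> proj2 X A = k \<cdot> (f \<cdot> proj2 X A)"
      "(f \<cdot> (k \<oplus> \<one> A)) \<cdot> proj1 X' A = f \<cdot> proj1 X A \<cdot> k"
      "(f \<cdot> (k \<oplus> \<one> A)) \<cdot> proj2 X' A = f \<cdot> proj2 X A"
      by simp_all
    have "X \<in> Ob C" "X' \<in> Ob C"
      by simp_all
    note X = this
    show "iter_of_wand C wand X A (k \<cdot> f) = k \<cdot> iter_of_wand C wand X' A (f \<cdot> (k \<oplus> \<one> A))"
      unfolding iter_of_wand_eq[OF kf X(1) A] iter_of_wand_eq[OF fk X(2) A] eqs
      by (rule wand_dinaturality[OF proj(1,2)[OF f X(1) A] k proj(3)[OF f X(1) A]])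
  next
    fix X A F
    assume X: "X \<in> Ob C" "A \<in> Ob C" and F: "F \<in> hom C X (X \<boxplus> (X \<boxplus> A))"
    note [simp] = X homD[OF F]
    define f where "f = F \<cdot> proj1 X (X \<boxplus> A)"
    define r where "r = F \<cdot> proj2 X (X \<boxplus> A)"
    define f' where "f' = r \<cdot> proj1 X A"
    define g where "g = r \<cdot> proj2 X A"
    have XA: "X \<boxplus> A \<in> Ob C"
      by simp
    have f: "f \<in> hom C X X" and r: "r \<in> hom C X (X \<boxplus> A)" and fr: "perp_d C f r"
      unfolding f_def r_def by (rule proj[OF F X(1) XA])+
    have f': "f' \<in> hom C X X" and g: "g \<in> hom C X A"
      unfolding f'_def g_def by (rule proj[OF r X])+
    \<comment> \<open>Projecting away the final exit \<open>A\<close> of \<open>F\<close> leaves the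
      pairing of \<open>f\<close> and \<open>f'\<close>, which shows them separated and computes
      their join.\<close>
    define P where "P = F \<cdot> (\<one> X \<oplus> proj1 X A)"
    have P: "P \<in> hom C X (X \<boxplus> X)"
      unfolding P_def by (simp add: hom_iff)
    have P_eqs: "P \<cdot> proj1 X X = f" "P \<cdot> proj2 X X = f'"
      unfolding P_def f_def f'_def r_def by simp_all
    have ff': "perp_d C f f'"
      using perp_d_proj[OF P X(1) X(1)] unfolding P_eqs .
    define G where "G = F \<cdot> \<alpha> X X A \<cdot> (\<nabla> X \<oplus> \<one> A)"
    have G: "G \<in> hom C X (X \<boxplus> A)"
      unfolding G_def by (simp add: hom_iff)
    have G_eqs: "G \<cdot> proj1 X A = f \<squnion> f'" "G \<cdot> proj2 X A = g"
      using join_proj[OF P X(1)] unfolding P_eqs unfolding G_def P_def g_def r_def by simp_all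
    have jg: "perp_d C (f \<squnion> f') g"
      using perp_d_proj[OF G X] unfolding G_eqs .
    have I: "iter_of_wand C wand X (X \<boxplus> A) F = wand f r"
      unfolding f_def r_def by (rule iter_of_wand_eq[OF F X(1) XA])
    \<comment> \<open>Naturality splits the inner iterate into the two wands on the right of the
      wand diagonal law.\<close>
    have "wand f r \<cdot> proj1 X A = wand f f'" "wand f r \<cdot> proj2 X A = wand f g"
      unfolding f'_def g_def by (rule wand_naturality[OF f r fr], simp add: hom_iff)+
    then have "iter_of_wand C wand X A (wand f r) = wand (wand f f') (wand f g)"
      using iter_of_wand_eq[OF wand_hom[OF f r fr] X] by simp
    also have "\<dots> = wand (f \<squnion> f') g"
      by (rule wand_diagonal[OF f f' g ff' jg, symmetric])
    also have "\<dots> = iter_of_wand C wand X A G"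
      using iter_of_wand_eq[OF G X] unfolding G_eqs by simp
    finally show "iter_of_wand C wand X A (iter_of_wand C wand X (X \<boxplus> A) F) =
        iter_of_wand C wand X A (F \<cdot> \<alpha> X X A \<cdot> (\<nabla> X \<oplus> \<one> A))"
      unfolding I G_def .
  qed
qed

lemma iter_of_wand_of_iter:
  assumes "parametrized_iteration_operator C Iter"
  shows "iter_of_wand C (wand_of_iter C Iter) = Iter"
proof (intro ext)
  interpret parametrized_iteration_operator C Iter by fact
  fix X A f
  show "iter_of_wand C (wand_of_iter C Iter) X A f = Iter X A f"
  proof (cases "iter_dom C X A f")
    case True
    then have f: "f \<in> hom C X (X \<boxplus> A)" "X \<in> Ob C" "A \<in> Ob C"
      by (simp_all add: iter_dom_def)
    show ?thesis
      unfolding iter_of_wand_eq[OF f] by (rule wand_of_iter_proj[OF f])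
  qed (simp add: iter_of_wand_def iter_undefined)
qed

lemma wand_of_iter_of_wand:
  assumes "kleene_wand C (perp_d C) wand"
  shows "wand_of_iter C (iter_of_wand C wand) = wand"
proof (intro ext)
  interpret kleene_wand C "perp_d C" wand by fact
  fix f g
  show "wand_of_iter C (iter_of_wand C wand) f g = wand f g"
  proof (cases "wand_dom C (perp_d C) f g")
    case True
    then obtain h X A where X: "X \<in> Ob C" "A \<in> Ob C" and h: "h \<in> hom C X (X \<boxplus> A)"
      and fg: "f = h \<cdot> proj1 X A" "g = h \<cdot> proj2 X A"
      by (rule wand_domE)
    show ?thesis
      unfolding fg wand_of_iter_proj[OF h X] by (rule iter_of_wand_eq[OF h X])
  qed (simp add: wand_of_iter_def wand_undefined)
qed

end

section \<open>Assembling the bijections\<close>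

lemma bij_betw_inverse_pair:
  assumes "\<And>x. x \<in> A \<Longrightarrow> f x \<in> B" "\<And>y. y \<in> B \<Longrightarrow> g y \<in> A"
    "\<And>x. x \<in> A \<Longrightarrow> g (f x) = x" "\<And>y. y \<in> B \<Longrightarrow> f (g y) = y"
  shows "bij_betw f A B" "\<forall>y\<in>B. inv_into A f y = g y" "bij_betw g B A"
proof -
  show bij: "bij_betw f A B"
    by (rule bij_betw_byWitness[where f' = g]) (use assms in auto)
  show "bij_betw g B A"
    by (rule bij_betw_byWitness[where f' = f]) (use assms in auto)
  show "\<forall>y\<in>B. inv_into A f y = g y"
    using bij assms by (metis bij_betw_def inv_into_f_eq)
qed

theorem theorem9p11:
  fixes X :: "('o, 'a) coprod_restr_category"
  assumes "extensive_restriction_category X"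
  defines "Iters \<equiv> {it. parametrized_iteration_operator X it}"
    and "Traces \<equiv> {tr. trace_operator X tr}"
    and "Wands \<equiv> {w. kleene_wand X (perp_d X) w}"
  shows
    "(bij_betw (wand_of_iter X) Iters Wands \<and>
        (\<forall>w\<in>Wands. inv_into Iters (wand_of_iter X) w = iter_of_wand X w)) \<and>
     (bij_betw (trace_of_iter X) Iters Traces \<and>
        (\<forall>tr\<in>Traces. inv_into Iters (trace_of_iter X) tr = iter_of_trace X tr)) \<and>
     bij_betw (\<lambda>tr. wand_of_iter X (iter_of_trace X tr)) Traces Wands \<and>
     bij_betw (\<lambda>tr. wand_of_iter X (iter_of_trace X tr))
       {tr. traced_extensive_restriction_category X tr}
       {w. extensive_restriction_category X \<and> itegory X (perp_d X) w}"
proof -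
  interpret extensive_restriction_category X by fact
  note wands = bij_betw_inverse_pair[of Iters "wand_of_iter X" Wands "iter_of_wand X"]
  have wand_bij: "bij_betw (wand_of_iter X) Iters Wands"
    and wand_inv: "\<forall>w\<in>Wands. inv_into Iters (wand_of_iter X) w = iter_of_wand X w"
    by (rule wands; simp add: Iters_def Wands_def kleene_wand_wand_of_iter
        parametrized_iteration_operator_iter_of_wand iter_of_wand_of_iter wand_of_iter_of_wand)+
  note traces = bij_betw_inverse_pair[of Iters "trace_of_iter X" Traces "iter_of_trace X"]
  have trace_bij: "bij_betw (trace_of_iter X) Iters Traces" "bij_betw (iter_of_trace X) Traces Iters"
    and trace_inv: "\<forall>tr\<in>Traces. inv_into Iters (trace_of_iter X) tr = iter_of_trace X tr"
    by (rule traces; simp add: Iters_def Traces_def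
        parametrized_iteration_operator.trace_operator_trace_of_iter
        trace_operator.parametrized_iteration_operator_iter_of_trace
        parametrized_iteration_operator.iter_of_trace_of_iter
        trace_operator.trace_of_iter_of_trace)+
  have comp: "bij_betw (\<lambda>tr. wand_of_iter X (iter_of_trace X tr)) Traces Wands"
    using bij_betw_trans[OF trace_bij(2) wand_bij] by (simp add: o_def)
  \<comment> \<open>With \<open>X\<close> fixed and extensive, its traced structures are its trace
    operators and its itegory structures for \<open>perp_d\<close> are its wands, so the final
    bijection is the composite already obtained.\<close>
  moreover have "{tr. traced_extensive_restriction_category X tr} = Traces"
    using assms(1) by (auto simp: Traces_def traced_extensive_restriction_category_def)
  moreover have "{w. extensive_restriction_category X \<and> itegory X (perp_d X) w} = Wands"
    using assms(1) by (auto simp: Wands_def itegory_def)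
  ultimately show ?thesis
    using wand_bij wand_inv trace_bij(1) trace_inv by simp
qed

end
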